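(* Let $q$ be a prime power and $m\ge1$. Given linearized polynomials $a,b$ over $\mathbb{F}_{q^m}$ of $q$-degree less than $m$, the product of $a$ and $b$ modulo $x^{[m]}-x$ (i.e., the remainder of $a\cdot b$ upon right division by $x^{[m]}-x$) can be computed in $\mathcal{O}(m^\omega)$ operations over $\mathbb{F}_q$.
   Context: Write $[i]:=q^i$. A linearized polynomial over $\mathbb{F}_{q^m}$ is a polynomial $a=\sum_k a_k x^{[k]}$, $a_k\in\mathbb{F}_{q^m}$, with $q$-degree $\deg_q a=\max\{k:a_k\ne0\}$ ($\deg_q0=-\infty$). Addition is coefficient-wise and multiplication is composition, $a\cdot b=\sum_i\left(\sum_{j=0}^i a_jb_{i-j}^{[j]}\right)x^{[i]}$. For $a,c$ with $c\neq0$ there are unique $\chi,\varrho$ with $a=\chi\cdot c+\varrho$, $\deg_q\varrho<\deg_q c$ (right division); $a\equiv b \bmod c$ means $a=b+d\cdot c$ for some linearized polynomial $d$. Here complexity counts operations in the base field $\mathbb{F}_q$. Elements of $\mathbb{F}_{q^m}$ are represented by coordinate vectors with respect to an $\mathbb{F}_q$-basis of $\mathbb{F}_{q^m}$ in which, by a result of Couveignes and Lercier, arithmetic operations of $\mathbb{F}_{q^m}$ cost $\mathcal{O}(m)$ operations over $\mathbb{F}_q$ up to logarithmic factors in $m$. $\omega\le3$ denotes the matrix multiplication exponent: two $N\times N$ matrices over a field can be multiplied in $\mathcal{O}(N^\omega)$ field operations; as usual in such estimates, costs of size $m^2$ times logarithmic factors are regarded as dominated by $m^\omega$. *)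

theory Defs
  imports
    "HOL-Algebra.Algebraic_Closure_Type"
    "HOL-Computational_Algebra.Computational_Algebra"
    "HOL-Library.Cardinality"
    "HOL-Library.Extended_Real"
    "HOL-Library.Landau_Symbols"
    "Jordan_Normal_Form.Matrix"
begin

section \<open>Finite extension fields and linearized polynomials\<close>

text \<open>
  The base field with \<open>q\<close> elements is a type \<open>'f :: finite_field\<close>, so \<open>q = CARD('f)\<close>. All its
  finite extensions live in the type \<open>'f alg_closure\<close>, in which there is exactly one subfield
  with \<open>q ^ m\<close> elements: the splitting field of \<open>x ^ (q ^ m) - x\<close>.
\<close>

definition GF :: "nat \<Rightarrow> 'f::finite_field alg_closure set" where
  "GF m = {x. x ^ (CARD('f) ^ m) = x}"

global_interpretation ac: vector_space "\<lambda>(c::'f::finite_field) (x::'f alg_closure). to_ac c * x"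
  by unfold_locales (simp_all add: algebra_simps)

definition is_basis :: "nat \<Rightarrow> 'f::finite_field alg_closure list \<Rightarrow> bool" where
  "is_basis m bs \<longleftrightarrow> distinct bs \<and> ac.independent (set bs) \<and> ac.span (set bs) = GF m"

definition coords :: "'f::finite_field alg_closure list \<Rightarrow> 'f alg_closure \<Rightarrow> 'f list" where
  "coords bs x = map (ac.representation (set bs) x) bs"

definition lin_polys :: "nat \<Rightarrow> 'f::finite_field alg_closure poly set" where
  "lin_polys m = {a. (\<forall>n. coeff a n \<in> GF m) \<and> (\<forall>n. coeff a n \<noteq> 0 \<longrightarrow> (\<exists>k. n = CARD('f) ^ k))}"

definition qdeg :: "'f::finite_field alg_closure poly \<Rightarrow> ereal" where
  "qdeg a = (if a = 0 then -\<infinity> else ereal (real (Max {k. coeff a (CARD('f) ^ k) \<noteq> 0})))"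

text \<open>The product of linearized polynomials is composition, i.e. \<open>a \<circ>\<^sub>p b\<close>.\<close>

definition right_rem ::
  "nat \<Rightarrow> 'f::finite_field alg_closure poly \<Rightarrow> 'f alg_closure poly \<Rightarrow> 'f alg_closure poly" where
  "right_rem m a c = (THE r. r \<in> lin_polys m \<and> qdeg r < qdeg c \<and>
                         (\<exists>d\<in>lin_polys m. a = d \<circ>\<^sub>p c + r))"

text \<open>Coordinates of the coefficients of \<open>x ^ (q ^ k)\<close> for \<open>k < m\<close>.\<close>

definition lin_coords ::
  "nat \<Rightarrow> 'f::finite_field alg_closure list \<Rightarrow> 'f alg_closure poly \<Rightarrow> 'f list" where
  "lin_coords m bs a = concat (map (\<lambda>k. coords bs (coeff a (CARD('f) ^ k))) [0..<m])"


section \<open>Straight-line programs\<close>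

text \<open>
  Registers form a list, initially the input; each instruction appends one register. Operands are
  register indices. Reading a missing register or dividing by zero makes the run fail. The cost
  is the number of arithmetic operations; loading a constant is free.
\<close>

datatype 'a instr = Const 'a | Add nat nat | Sub nat nat | Mult nat nat | Div nat nat

fun step :: "'a::Fields.field instr \<Rightarrow> 'a list \<Rightarrow> 'a option" where
  "step (Const c) rs = Some c"
| "step (Add i j) rs = (if i < length rs \<and> j < length rs then Some (rs ! i + rs ! j) else None)"
| "step (Sub i j) rs = (if i < length rs \<and> j < length rs then Some (rs ! i - rs ! j) else None)"
| "step (Mult i j) rs = (if i < length rs \<and> j < length rs then Some (rs ! i * rs ! j) else None)"
| "step (Div i j) rs =
     (if i < length rs \<and> j < length rs \<and> rs ! j \<noteq> 0 then Some (rs ! i / rs ! j) else None)"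

fun exec :: "'a::Fields.field instr list \<Rightarrow> 'a list \<Rightarrow> 'a list option" where
  "exec [] rs = Some rs"
| "exec (I # Is) rs = (case step I rs of None \<Rightarrow> None | Some x \<Rightarrow> exec Is (rs @ [x]))"

text \<open>A program is an instruction list together with the indices of the output registers.\<close>

type_synonym 'a program = "'a instr list \<times> nat list"

fun run :: "'a::Fields.field program \<Rightarrow> 'a list \<Rightarrow> 'a list option" where
  "run (Is, outs) xs = (case exec Is xs of None \<Rightarrow> None
     | Some rs \<Rightarrow> if \<forall>i\<in>set outs. i < length rs then Some (map (\<lambda>i. rs ! i) outs) else None)"

fun is_Const :: "'a instr \<Rightarrow> bool" where
  "is_Const (Const c) = True"
| "is_Const _ = False"

definition cost :: "'a program \<Rightarrow> nat" where
  "cost P = length (filter (\<lambda>I. \<not> is_Const I) (fst P))"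

text \<open>
  The map sending the problem instance \<open>x \<in> D\<close>, encoded as \<open>inp x\<close>, to \<open>out x\<close> can be computed with
  at most \<open>t\<close> operations.
\<close>

definition computable_within ::
  "nat \<Rightarrow> 'x set \<Rightarrow> ('x \<Rightarrow> 'a::Fields.field list) \<Rightarrow> ('x \<Rightarrow> 'a list) \<Rightarrow> bool" where
  "computable_within t D inp out \<longleftrightarrow>
     (\<exists>P. cost P \<le> t \<and> (\<forall>x\<in>D. run P (inp x) = Some (out x)))"


section \<open>Cost of matrix multiplication and of extension field arithmetic\<close>

definition matmul_in :: "'a::Fields.field itself \<Rightarrow> real \<Rightarrow> bool" where
  "matmul_in _ \<omega> \<longleftrightarrow> (\<exists>T. (\<lambda>N. real (T N)) \<in> O(\<lambda>N. real N powr \<omega>) \<and>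
     (\<forall>N. computable_within (T N) (carrier_mat N N \<times> carrier_mat N N :: ('a mat \<times> 'a mat) set)
            (\<lambda>(A, B). concat (mat_to_list A) @ concat (mat_to_list B))
            (\<lambda>(A, B). concat (mat_to_list (A * B)))))"

definition field_arith_within :: "nat \<Rightarrow> nat \<Rightarrow> 'f::finite_field alg_closure list \<Rightarrow> bool" where
  "field_arith_within t m bs \<longleftrightarrow>
     computable_within t (GF m \<times> GF m)
       (\<lambda>(x, y). coords bs x @ coords bs y) (\<lambda>(x, y). coords bs (x + y)) \<and>
     computable_within t (GF m \<times> GF m)
       (\<lambda>(x, y). coords bs x @ coords bs y) (\<lambda>(x, y). coords bs (x - y)) \<and>
     computable_within t (GF m \<times> GF m)
       (\<lambda>(x, y). coords bs x @ coords bs y) (\<lambda>(x, y). coords bs (x * y)) \<and>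
     computable_within t (GF m \<times> (GF m - {0}))
       (\<lambda>(x, y). coords bs x @ coords bs y) (\<lambda>(x, y). coords bs (x / y))"

text \<open>
  Bases, one for each \<open>m\<close>, with respect to which field arithmetic costs \<open>O(m)\<close> up to logarithmic
  factors.
\<close>

definition fast_bases :: "(nat \<Rightarrow> 'f::finite_field alg_closure list) \<Rightarrow> bool" where
  "fast_bases bs \<longleftrightarrow> (\<forall>m\<ge>1. is_basis m (bs m)) \<and>
     (\<exists>T k. (\<lambda>m. real (T m)) \<in> O(\<lambda>m. real m * ln (real m) ^ k) \<and>
            (\<forall>m\<ge>1. field_arith_within (T m) m (bs m)))"

end

theory Submission
  imports Defs "HOL-Algebra.Sylow" "HOL-Real_Asymp.Real_Asymp"
begin

text \<open>
  Let \<open>\<beta>\<close> generate a normal basis of \<open>GF m\<close>. The coefficients \<open>a\<^sub>k\<close> and the values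
  \<open>a(\<beta>\<^sub>j) = \<Sum>\<^sub>k a\<^sub>k \<beta>\<^bsub>j + k\<^esub>\<close> at the basis elements \<open>\<beta>\<^sub>j\<close>, the conjugates of \<open>\<beta>\<close>, determine each other
  by Hankel matrices with constant entries, so either conversion is one product of a polynomial
  with a constant polynomial over \<open>GF m\<close>. Since \<open>m\<^sup>2\<close> times logarithmic factors is
  \<open>O(m powr \<omega>)\<close>, the exponent \<open>\<omega>\<close> exceeds \<open>2\<close>; hence Toom-Cook multiplication with
  \<open>O(m powr (1 + \<epsilon>))\<close> field operations is fast enough. On the level of values, the composition
  modulo \<open>x ^ (q ^ m) - x\<close> is a product of three matrices over the base field: the coordinates of the
  values of \<open>b\<close>, a constant change of basis, and the coordinates of the values of \<open>a\<close>.
\<close>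

section \<open>Composing straight-line programs\<close>

text \<open>The coefficient formula for the composition takes about m^2 products in the extension
  field, hence about m^3 base field operations. Over the base field the product is a composition of
  linear maps of an m-dimensional space, and the passage between coefficients and values becomes the
  bottleneck. For an arbitrary basis the evaluation matrix lacks the structure needed here; for a
  normal basis its entry (j, k) depends on j + k only, since Frobenius moves each conjugate to the
  next. Toom-Cook with r = 2^s blocks is bounded with exponent 1 + 1/s. Field operations cost about
  m each, so the total exponent is 2 + 1/s, and s is chosen with 1/s < \<omega> - 2. The method
  needs 2r - 1 distinct points of \<open>GF m\<close>. As r depends on \<omega> only, just finitely
  many m lack them, and these are treated naively. Each m has its own program and constants are
  free, so the normal basis, the inverse Hankel matrix and the interpolation weights are not
  computed by the programs.\<close>

fun relocate :: "(nat \<Rightarrow> nat) \<Rightarrow> 'a instr \<Rightarrow> 'a instr" where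
  "relocate \<rho> (Const c) = Const c"
| "relocate \<rho> (Add i j) = Add (\<rho> i) (\<rho> j)"
| "relocate \<rho> (Sub i j) = Sub (\<rho> i) (\<rho> j)"
| "relocate \<rho> (Mult i j) = Mult (\<rho> i) (\<rho> j)"
| "relocate \<rho> (Div i j) = Div (\<rho> i) (\<rho> j)"

lemma is_Const_relocate [simp]: "is_Const (relocate \<rho> I) = is_Const I"
  by (cases I) auto

lemma exec_append:
  "exec (Is @ Js) rs = (case exec Is rs of None \<Rightarrow> None | Some rs' \<Rightarrow> exec Js rs')"
  by (induction Is arbitrary: rs) (auto split: option.splits)

lemma exec_extends: "exec Is rs = Some rs' \<Longrightarrow> \<exists>new. rs' = rs @ new \<and> length new = length Is"
proof (induction Is arbitrary: rs)
  case (Cons I Is)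
  then obtain x where "exec Is (rs @ [x]) = Some rs'"
    by (auto split: option.splits)
  from Cons.IH[OF this] show ?case by auto
qed simp

lemma step_relocate:
  assumes "step I rs = Some x" and "\<And>i. i < length rs \<Longrightarrow> \<rho> i < length rs2 \<and> rs2 ! \<rho> i = rs ! i"
  shows "step (relocate \<rho> I) rs2 = Some x"
  using assms by (cases I) (auto split: if_splits)

text \<open>A simulation argument: \<open>\<rho>\<close> has to find every old register with the
  right value and to shift the registers created by the program uniformly. Each executed instruction
  turns a created register into an old one, and both conditions survive this.\<close>

lemma exec_relocate:
  assumes "exec Is rs = Some (rs @ new)"
    and "\<And>i. i < length rs \<Longrightarrow> \<rho> i < length rs2 \<and> rs2 ! \<rho> i = rs ! i"
    and "\<And>j. \<rho> (length rs + j) = length rs2 + j"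
  shows "exec (map (relocate \<rho>) Is) rs2 = Some (rs2 @ new)"
  using assms
proof (induction Is arbitrary: rs rs2 new)
  case (Cons I Is)
  then obtain x where x: "step I rs = Some x" and ex: "exec Is (rs @ [x]) = Some (rs @ new)"
    by (auto split: option.splits)
  from exec_extends[OF ex] obtain new' where new: "new = x # new'"
    by auto
  have "exec (map (relocate \<rho>) Is) (rs2 @ [x]) = Some ((rs2 @ [x]) @ new')"
  proof (rule Cons.IH)
    show "exec Is (rs @ [x]) = Some ((rs @ [x]) @ new')"
      using ex new by simp
    show "\<rho> i < length (rs2 @ [x]) \<and> (rs2 @ [x]) ! \<rho> i = (rs @ [x]) ! i"
      if "i < length (rs @ [x])" for i
    proof (cases "i < length rs")
      case True
      then show ?thesis using Cons.prems(2)[of i] by (auto simp: nth_append)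
    next
      case False
      then have "i = length rs" using that by simp
      then show ?thesis using Cons.prems(3)[of 0] by simp
    qed
    show "\<rho> (length (rs @ [x]) + j) = length (rs2 @ [x]) + j" for j
      using Cons.prems(3)[of "Suc j"] by simp
  qed
  then show ?case
    using step_relocate[OF x Cons.prems(2)] new by simp
qed simp

lemma run_SomeD:
  assumes "run (Is, outs) xs = Some ys"
  obtains new where "exec Is xs = Some (xs @ new)" "length new = length Is"
    "\<And>i. i \<in> set outs \<Longrightarrow> i < length xs + length Is" "ys = map ((!) (xs @ new)) outs"
proof -
  from assms obtain rs where rs: "exec Is xs = Some rs" "\<forall>i\<in>set outs. i < length rs"
    "ys = map ((!) rs) outs"
    by (auto split: option.splits if_splits)
  with exec_extends[OF rs(1)] that show thesis by auto
qed

text \<open>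
  Register numbers of a program that is run after another one depend on the input length, so
  composition needs all instances to have encodings of the same length.
\<close>

definition uniform :: "'x set \<Rightarrow> ('x \<Rightarrow> 'a list) \<Rightarrow> bool" where
  "uniform D inp \<longleftrightarrow> (\<exists>n. \<forall>x\<in>D. length (inp x) = n)"

lemma uniformI: "(\<And>x. x \<in> D \<Longrightarrow> length (inp x) = n) \<Longrightarrow> uniform D inp"
  by (auto simp: uniform_def)

section \<open>Closure properties of computability within a cost bound\<close>

lemma computable_within_mono:
  "computable_within s D inp out \<Longrightarrow> s \<le> t \<Longrightarrow> computable_within t D inp out"
  unfolding computable_within_def by (meson order_trans)

lemma computable_within_cong:
  assumes "computable_within t D inp out"
    and "\<And>x. x \<in> D \<Longrightarrow> inp' x = inp x" "\<And>x. x \<in> D \<Longrightarrow> out' x = out x"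
  shows "computable_within t D inp' out'"
  using assms unfolding computable_within_def by auto

lemma computable_within_instance:
  assumes "computable_within t D inp out" and "\<And>x. x \<in> D' \<Longrightarrow> h x \<in> D"
  shows "computable_within t D' (\<lambda>x. inp (h x)) (\<lambda>x. out (h x))"
  using assms unfolding computable_within_def by blast

lemma computable_within_seq:
  assumes unif: "uniform D inp"
    and f: "computable_within s D inp f" and g: "computable_within t D f g"
  shows "computable_within (s + t) D inp g"
proof -
  obtain n where n: "\<And>x. x \<in> D \<Longrightarrow> length (inp x) = n"
    using unif by (auto simp: uniform_def)
  obtain Is outs where P: "cost (Is, outs) \<le> s" "\<And>x. x \<in> D \<Longrightarrow> run (Is, outs) (inp x) = Some (f x)"
    using f unfolding computable_within_def by auto
  obtain Js outs' where Q: "cost (Js, outs') \<le> t" "\<And>x. x \<in> D \<Longrightarrow> run (Js, outs') (f x) = Some (g x)"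
    using g unfolding computable_within_def by auto
  \<comment> \<open>The second program reads its input directly from the output registers of the
    first, so nothing is copied; its own registers follow the \<open>n + length Is\<close> registers
    present by then.\<close>
  define \<rho> where "\<rho> i = (if i < length outs then outs ! i else n + length Is + (i - length outs))" for i
  have "run (Is @ map (relocate \<rho>) Js, map \<rho> outs') (inp x) = Some (g x)" if x: "x \<in> D" for x
  proof -
    obtain new where new: "exec Is (inp x) = Some (inp x @ new)" "length new = length Is"
      "\<And>i. i \<in> set outs \<Longrightarrow> i < n + length Is" "f x = map ((!) (inp x @ new)) outs"
      using run_SomeD[OF P(2)[OF x]] n[OF x] by metis
    obtain new' where new': "exec Js (f x) = Some (f x @ new')" "length new' = length Js"
      "\<And>i. i \<in> set outs' \<Longrightarrow> i < length (f x) + length Js" "g x = map ((!) (f x @ new')) outs'"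
      using run_SomeD[OF Q(2)[OF x]] by metis
    have len: "length (f x) = length outs"
      using new(4) by simp
    have "exec (map (relocate \<rho>) Js) (inp x @ new) = Some ((inp x @ new) @ new')"
    proof (rule exec_relocate[OF new'(1)])
      show "\<rho> i < length (inp x @ new) \<and> (inp x @ new) ! \<rho> i = f x ! i" if "i < length (f x)" for i
        using that new(2,3) n[OF x] len by (auto simp: \<rho>_def new(4))
      show "\<rho> (length (f x) + j) = length (inp x @ new) + j" for j
        using new(2) n[OF x] len by (auto simp: \<rho>_def)
    qed
    then have ex: "exec (Is @ map (relocate \<rho>) Js) (inp x) = Some (inp x @ new @ new')"
      using new(1) by (simp add: exec_append)
    have "\<rho> i < length (inp x @ new @ new') \<and> (inp x @ new @ new') ! \<rho> i = (f x @ new') ! i"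
      if "i \<in> set outs'" for i
    proof (cases "i < length outs")
      case True
      then have "\<rho> i < n + length Is" "(inp x @ new) ! \<rho> i = f x ! i"
        using new(3) by (auto simp: \<rho>_def new(4))
      then show ?thesis
        using True new(2) n[OF x] len by (auto simp: nth_append)
    next
      case False
      then show ?thesis
        using new'(3)[OF that] new'(2) new(2) n[OF x] len by (auto simp: \<rho>_def nth_append)
    qed
    then show ?thesis
      using ex new'(4) by auto
  qed
  moreover have "cost (Is @ map (relocate \<rho>) Js, map \<rho> outs') \<le> s + t"
    using P(1) Q(1) by (simp add: cost_def filter_map comp_def)
  ultimately show ?thesis
    unfolding computable_within_def by blast
qed

lemma computable_within_append:
  assumes unif: "uniform D inp"
    and f: "computable_within s D inp f" and g: "computable_within t D inp g"
  shows "computable_within (s + t) D inp (\<lambda>x. f x @ g x)"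
proof -
  obtain n where n: "\<And>x. x \<in> D \<Longrightarrow> length (inp x) = n"
    using unif by (auto simp: uniform_def)
  obtain Is outs where P: "cost (Is, outs) \<le> s" "\<And>x. x \<in> D \<Longrightarrow> run (Is, outs) (inp x) = Some (f x)"
    using f unfolding computable_within_def by auto
  obtain Js outs' where Q: "cost (Js, outs') \<le> t" "\<And>x. x \<in> D \<Longrightarrow> run (Js, outs') (inp x) = Some (g x)"
    using g unfolding computable_within_def by auto
  \<comment> \<open>Both programs read the original input; only registers created by the second one
    move, past those of the first.\<close>
  define \<rho> where "\<rho> i = (if i < n then i else length Is + i)" for i
  have "run (Is @ map (relocate \<rho>) Js, outs @ map \<rho> outs') (inp x) = Some (f x @ g x)"
    if x: "x \<in> D" for x
  proof -
    obtain new where new: "exec Is (inp x) = Some (inp x @ new)" "length new = length Is"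
      "\<And>i. i \<in> set outs \<Longrightarrow> i < n + length Is" "f x = map ((!) (inp x @ new)) outs"
      using run_SomeD[OF P(2)[OF x]] n[OF x] by metis
    obtain new' where new': "exec Js (inp x) = Some (inp x @ new')" "length new' = length Js"
      "\<And>i. i \<in> set outs' \<Longrightarrow> i < n + length Js" "g x = map ((!) (inp x @ new')) outs'"
      using run_SomeD[OF Q(2)[OF x]] n[OF x] by metis
    have "exec (map (relocate \<rho>) Js) (inp x @ new) = Some ((inp x @ new) @ new')"
      by (rule exec_relocate[OF new'(1)]) (use new(2) n[OF x] in \<open>auto simp: \<rho>_def nth_append\<close>)
    then have ex: "exec (Is @ map (relocate \<rho>) Js) (inp x) = Some (inp x @ new @ new')"
      using new(1) by (simp add: exec_append)
    have "\<rho> i < length (inp x @ new @ new') \<and> (inp x @ new @ new') ! \<rho> i = (inp x @ new') ! i"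
      if "i \<in> set outs'" for i
      using that new'(2,3) new(2) n[OF x] by (auto simp: \<rho>_def nth_append)
    moreover have "i < length (inp x @ new @ new') \<and> (inp x @ new @ new') ! i = (inp x @ new) ! i"
      if "i \<in> set outs" for i
      using new(2) new(3)[OF that] n[OF x] by (auto simp: nth_append)
    ultimately show ?thesis
      using ex new(4) new'(4) by auto
  qed
  moreover have "cost (Is @ map (relocate \<rho>) Js, outs @ map \<rho> outs') \<le> s + t"
    using P(1) Q(1) by (simp add: cost_def filter_map comp_def)
  ultimately show ?thesis
    unfolding computable_within_def by blast
qed

text \<open>An output is just a list of register numbers, so selecting, permuting and repeating data
  is free.\<close>

lemma computable_within_select:
  assumes "\<And>x i. x \<in> D \<Longrightarrow> i \<in> set ks \<Longrightarrow> i < length (inp x)"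
  shows "computable_within 0 D inp (\<lambda>x. map ((!) (inp x)) ks)"
  unfolding computable_within_def
  by (rule exI[of _ "([], ks)"]) (use assms in \<open>auto simp: cost_def\<close>)

lemma computable_within_fst:
  assumes "\<And>x. x \<in> D \<Longrightarrow> length (f x) = n"
  shows "computable_within 0 D (\<lambda>x. f x @ g x) f"
  by (rule computable_within_cong[OF computable_within_select[where ks = "[0..<n]"]])
    (use assms in \<open>auto simp: nth_append intro!: nth_equalityI\<close>)

lemma computable_within_snd:
  assumes "\<And>x. x \<in> D \<Longrightarrow> length (f x) = n" "\<And>x. x \<in> D \<Longrightarrow> length (g x) = k"
  shows "computable_within 0 D (\<lambda>x. f x @ g x) g"
  by (rule computable_within_cong[OF computable_within_select[where ks = "[n..<n + k]"]])
    (use assms in \<open>auto simp: nth_append intro!: nth_equalityI\<close>)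

text \<open>Loading constants is free; this is how precomputed field elements and the change of
  basis enter the programs.\<close>

lemma computable_within_const:
  assumes "uniform D inp"
  shows "computable_within 0 D inp (\<lambda>_. cs)"
proof -
  obtain n where n: "\<And>x. x \<in> D \<Longrightarrow> length (inp x) = n"
    using assms by (auto simp: uniform_def)
  have ex: "exec (map Const cs) xs = Some (xs @ cs)" for xs
    by (induction cs arbitrary: xs) auto
  have "filter (\<lambda>I. \<not> is_Const I) (map Const cs) = []"
    by (induction cs) auto
  then have "cost (map Const cs, [n..<n + length cs]) = 0"
    by (simp add: cost_def)
  moreover have "\<forall>x\<in>D. run (map Const cs, [n..<n + length cs]) (inp x) = Some cs"
    using n by (auto simp: ex nth_append intro!: nth_equalityI)
  ultimately show ?thesis
    unfolding computable_within_def by (metis order_refl)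
qed

lemma computable_within_concat:
  assumes unif: "uniform D inp"
    and w: "\<And>k. k < n \<Longrightarrow> computable_within t D inp (\<lambda>x. w x k)"
  shows "computable_within (n * t) D inp (\<lambda>x. concat (map (w x) [0..<n]))"
  using w
proof (induction n)
  case 0
  show ?case using computable_within_const[OF unif, of "[]"] by simp
next
  case (Suc n)
  have "computable_within (n * t + t) D inp (\<lambda>x. concat (map (w x) [0..<n]) @ w x n)"
    by (rule computable_within_append[OF unif]) (use Suc in auto)
  then show ?case by (simp add: add.commute)
qed

section \<open>Finite fields and normal bases\<close>

text \<open>Cauchy's theorem for the additive group, taken from Sylow: a subgroup of order r
  contains some x \<noteq> 0 with r * x = 0, so r vanishes in the field.\<close>

lemma prime_dvd_card_finite_field:
  assumes "prime r" "r dvd CARD('f::finite_field)"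
  shows "r = CHAR('f)"
proof (rule ccontr)
  assume neq: "r \<noteq> CHAR('f)"
  define G where "G = \<lparr>carrier = (UNIV :: 'f set), monoid.mult = (+) :: 'f \<Rightarrow> _, one = (0 :: 'f)\<rparr>"
  interpret group G
  proof (rule groupI)
    fix x assume "x \<in> carrier G"
    show "\<exists>y\<in>carrier G. y \<otimes>\<^bsub>G\<^esub> x = \<one>\<^bsub>G\<^esub>"
      by (intro bexI[of _ "-x"]) (auto simp: G_def)
  qed (auto simp: G_def add_ac)
  have pow: "x [^]\<^bsub>G\<^esub> (n::nat) = of_nat n * x" for x n
    by (induction n) (auto simp: G_def algebra_simps)
  obtain m where "CARD('f) = r ^ 1 * m"
    using assms(2) by auto
  then obtain H where H: "subgroup H G" "card H = r ^ 1"
    using sylow_thm[OF assms(1) is_group, of 1 m] by (auto simp: G_def Coset.order_def)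
  interpret H: group "G\<lparr>carrier := H\<rparr>"
    using H(1) by (rule subgroup_imp_group)
  have "H \<noteq> {0}"
    using H(2) prime_gt_1_nat[OF assms(1)] by auto
  moreover have "0 \<in> H"
    using subgroup.one_closed[OF H(1)] by (simp add: G_def)
  ultimately obtain x where x: "x \<in> H" "x \<noteq> 0"
    by blast
  have "x [^]\<^bsub>G\<lparr>carrier := H\<rparr>\<^esub> card H = \<one>\<^bsub>G\<lparr>carrier := H\<rparr>\<^esub>"
    using H.pow_order_eq_1[of x] x by (simp add: Coset.order_def)
  then have "of_nat r * x = 0"
    using H(2) pow[of x r] nat_pow_consistent[of x r H] by (simp add: G_def)
  then have "of_nat r = (0 :: 'f)"
    using x by simp
  then have "CHAR('f) dvd r"
    by (simp add: of_nat_eq_0_iff_char_dvd)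
  then show False
    using neq primes_dvd_imp_eq[OF CHAR_prime[where 'a = 'f] assms(1)] by simp
qed

text \<open>The freshman's dream concerns powers of the characteristic; this makes it available for
  powers of q. A prime factor of the cofactor would again have to be the characteristic.\<close>

lemma card_finite_field: "\<exists>n. CARD('f::finite_field) = CHAR('f) ^ n"
proof -
  obtain m where m: "CARD('f) = CHAR('f) ^ multiplicity CHAR('f) CARD('f) * m" "\<not> CHAR('f) dvd m"
  proof (rule multiplicity_decompose'[of "CARD('f)" "CHAR('f)"])
    show "\<not> CHAR('f) dvd 1"
      using CHAR_prime[where 'a = 'f] prime_nat_iff by auto
  qed auto
  have "m = 1"
  proof (rule ccontr)
    assume "m \<noteq> 1"
    then obtain r where r: "prime r" "r dvd m"
      using prime_factor_nat by blast
    then have "r dvd CARD('f)"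
      by (subst m(1)) simp
    then show False
      using prime_dvd_card_finite_field[OF r(1)] r m(2) by auto
  qed
  then show ?thesis
    using m(1) by auto
qed

lemma card_finite_field_power: "\<exists>n. CARD('f::finite_field) ^ k = CHAR('f) ^ n"
  using card_finite_field[where 'f = 'f] by (metis power_mult)

lemma card_finite_field_gt_1: "1 < CARD('f::finite_field)"
proof -
  have "card {0, 1 :: 'f} \<le> CARD('f)"
    by (rule card_mono) auto
  then show ?thesis by simp
qed

section \<open>Additivity of the Frobenius map\<close>

lemma frobenius_sum:
  fixes f :: "'b \<Rightarrow> 'f::finite_field alg_closure"
  shows "sum f A ^ (CARD('f) ^ k) = (\<Sum>i\<in>A. f i ^ (CARD('f) ^ k))"
proof -
  obtain n where "CARD('f) ^ k = CHAR('f) ^ n"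
    using card_finite_field_power by blast
  then show ?thesis
    by (intro freshmans_dream_sum') auto
qed

lemma frobenius_add:
  fixes x y :: "'f::finite_field alg_closure"
  shows "(x + y) ^ (CARD('f) ^ k) = x ^ (CARD('f) ^ k) + y ^ (CARD('f) ^ k)"
  using frobenius_sum[of "\<lambda>b. if b then x else y" UNIV k] by (simp add: UNIV_bool add.commute)

lemma frobenius_diff:
  fixes x y :: "'f::finite_field alg_closure"
  shows "(x - y) ^ (CARD('f) ^ k) = x ^ (CARD('f) ^ k) - y ^ (CARD('f) ^ k)"
  using frobenius_add[of "x - y" y k] by (simp add: algebra_simps)

lemma frobenius_sum_poly:
  fixes f :: "'b \<Rightarrow> 'f::finite_field alg_closure poly"
  shows "sum f A ^ (CARD('f) ^ k) = (\<Sum>i\<in>A. f i ^ (CARD('f) ^ k))"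
proof -
  obtain n where "CARD('f) ^ k = CHAR('f) ^ n"
    using card_finite_field_power by blast
  then show ?thesis
    by (intro freshmans_dream_sum') auto
qed

lemma to_ac_frobenius [simp]: "to_ac (c :: 'f::finite_field) ^ (CARD('f) ^ k) = to_ac c"
  using finite_field_power_card_power_eq_same[of "CARD('f) ^ k" k c] by (simp flip: to_ac_power)

section \<open>The subfield with q^m elements\<close>

lemma GF_0 [simp]: "0 \<in> GF m"
  by (simp add: GF_def)

lemma GF_1 [simp]: "1 \<in> GF m"
  by (simp add: GF_def)

lemma GF_to_ac [simp]: "to_ac c \<in> GF m"
  by (simp add: GF_def)

lemma GF_add [intro]: "x \<in> GF m \<Longrightarrow> y \<in> GF m \<Longrightarrow> x + y \<in> GF m"
  by (simp add: GF_def frobenius_add)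

lemma GF_diff [intro]: "x \<in> GF m \<Longrightarrow> y \<in> GF m \<Longrightarrow> x - y \<in> GF m"
  by (simp add: GF_def frobenius_diff)

lemma GF_uminus [intro]: "x \<in> GF m \<Longrightarrow> - x \<in> GF m"
  using GF_diff[of 0 m x] by simp

lemma GF_mult [intro]: "x \<in> GF m \<Longrightarrow> y \<in> GF m \<Longrightarrow> x * y \<in> GF m"
  by (simp add: GF_def power_mult_distrib)

lemma GF_power [intro]: "x \<in> GF m \<Longrightarrow> x ^ n \<in> GF m"
  by (induction n) auto

lemma GF_divide [intro]: "x \<in> GF m \<Longrightarrow> y \<in> GF m \<Longrightarrow> x / y \<in> GF m"
  by (simp add: GF_def power_divide)

lemma GF_sum [intro]: "(\<And>i. i \<in> A \<Longrightarrow> f i \<in> GF m) \<Longrightarrow> sum f A \<in> GF m"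
  by (induction A rule: infinite_finite_induct) auto

lemma GF_frobenius: "x \<in> GF m \<Longrightarrow> x ^ (CARD('f) ^ m) = (x :: 'f::finite_field alg_closure)"
  by (simp add: GF_def)

text \<open>The m-fold Frobenius is the identity on \<open>GF m\<close>. This makes the indices of
  conjugates cyclic modulo m.\<close>

lemma GF_frobenius_mod:
  fixes x :: "'f::finite_field alg_closure"
  assumes "x \<in> GF m"
  shows "x ^ (CARD('f) ^ (k mod m)) = x ^ (CARD('f) ^ k)"
proof -
  have "x ^ (CARD('f) ^ (m * j)) = x" for j
    by (induction j) (simp_all add: power_add power_mult GF_frobenius[OF assms])
  then have "x ^ (CARD('f) ^ (m * (k div m) + k mod m)) = x ^ (CARD('f) ^ (k mod m))"
    by (simp only: power_add power_mult)
  then show ?thesis by simp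
qed

text \<open>Over an algebraically closed field the polynomial splits, and a repeated linear factor
  would make the derivative vanish at its root; so the multiset of roots is a set.\<close>

lemma card_roots_separable:
  fixes p :: "'a::alg_closed_field poly"
  assumes p: "p \<noteq> 0" and sep: "\<And>x. poly p x = 0 \<Longrightarrow> poly (pderiv p) x \<noteq> 0"
  shows "card {x. poly p x = 0} = degree p"
proof -
  obtain A c where A: "size A = degree p" "p = smult c (\<Prod>x\<in>#A. [:-x, 1:])"
    using alg_closed_imp_factorization[OF p] by blast
  with p have "c \<noteq> 0" by auto
  have roots: "poly p x = 0 \<longleftrightarrow> x \<in># A" for x
    using \<open>c \<noteq> 0\<close> by (auto simp: A(2) poly_prod_mset prod_mset_zero_iff)
  have "count A x \<le> 1" for x
  proof (rule ccontr)
    assume "\<not> count A x \<le> 1"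
    then have "{#x, x#} \<subseteq># A"
      by (auto simp: subseteq_mset_def)
    then obtain B where "A = {#x, x#} + B"
      by (auto simp: subset_mset.le_iff_add)
    then have "(\<Prod>x\<in>#A. [:-x, 1:]) = [:-x, 1:] * [:-x, 1:] * (\<Prod>x\<in>#B. [:-x, 1:])"
      by (simp add: mult.assoc del: mult_pCons_left mult_pCons_right)
    then obtain s where s: "p = [:-x, 1:] * ([:-x, 1:] * s)"
      using A(2) by (intro that[of "smult c (\<Prod>x\<in>#B. [:-x, 1:])"])
        (simp add: mult.assoc del: mult_pCons_left mult_pCons_right)
    have "poly p x = 0"
      by (simp add: s del: mult_pCons_left)
    moreover have "poly (pderiv p) x = 0"
      unfolding s pderiv_mult[of "[:-x, 1:]"] poly_add poly_mult by simp
    ultimately show False using sep by blast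
  qed
  then have "count A x = (if x \<in># A then 1 else 0)" for x
    by (metis count_greater_eq_one_iff le_antisym not_in_iff)
  then have "A = mset_set (set_mset A)"
    by (intro multiset_eqI) (simp add: count_mset_set')
  then have "size A = card (set_mset A)"
    by (metis size_mset_set)
  then show ?thesis
    using A(1) roots by simp
qed

text \<open>The characteristic divides q^m, so the polynomial defining \<open>GF m\<close> has
  derivative -1 and is separable.\<close>

lemma card_GF:
  assumes "m \<ge> 1"
  shows "card (GF m :: 'f::finite_field alg_closure set) = CARD('f) ^ m"
proof -
  let ?N = "CARD('f) ^ m"
  define f :: "'f alg_closure poly" where "f = monom 1 ?N - monom 1 1"
  have N: "1 < ?N"
    using assms card_finite_field_gt_1[where 'f = 'f] by (intro one_less_power) auto
  obtain n where n: "?N = CHAR('f) ^ n"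
    using card_finite_field_power by blast
  with N have "n \<noteq> 0"
    by (intro notI) simp
  then have "CHAR('f) dvd ?N"
    by (simp add: n)
  then have "of_nat ?N = (0 :: 'f alg_closure)"
    by (simp only: of_nat_eq_0_iff_char_dvd CHAR_alg_closure)
  then have "pderiv f = - 1"
    unfolding f_def by (simp add: pderiv_diff pderiv_monom)
  moreover have deg: "degree f = ?N"
    unfolding f_def diff_conv_add_uminus
    by (subst degree_add_eq_left) (use N in \<open>auto simp: degree_monom_eq\<close>)
  moreover have "f \<noteq> 0"
    using deg N by auto
  ultimately have "card {x. poly f x = 0} = ?N"
    using card_roots_separable[of f] by simp
  then show ?thesis
    by (simp add: f_def GF_def poly_monom)
qed

lemma finite_GF: "m \<ge> 1 \<Longrightarrow> finite (GF m :: 'f::finite_field alg_closure set)"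
  using card_GF[of m, where 'f = 'f] by (intro card_ge_0_finite) simp

text \<open>\<open>GF m\<close> would supply more roots than the degree allows. Polynomials of
  degree below q^m can thus be compared by their values on \<open>GF m\<close>.\<close>

lemma poly_eq_0_on_GF:
  fixes a :: "'f::finite_field alg_closure poly"
  assumes "m \<ge> 1" "degree a < CARD('f) ^ m" "\<And>x. x \<in> GF m \<Longrightarrow> poly a x = 0"
  shows "a = 0"
proof (rule ccontr)
  assume a: "a \<noteq> 0"
  have "CARD('f) ^ m \<le> card {x. poly a x = 0}"
    using card_mono[OF poly_roots_finite[OF a], of "GF m"] assms card_GF[of m, where 'f = 'f] by auto
  then show False
    using card_poly_roots_bound[OF a] assms(2) by simp
qed

section \<open>Linearized polynomials with prescribed coefficients\<close>

definition linearized :: "nat \<Rightarrow> (nat \<Rightarrow> 'f::finite_field alg_closure) \<Rightarrow> 'f alg_closure poly" where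
  "linearized n c = (\<Sum>k<n. monom (c k) (CARD('f) ^ k))"

lemma coeff_linearized:
  "coeff (linearized n c :: 'f::finite_field alg_closure poly) (CARD('f) ^ k) = (if k < n then c k else 0)"
  using card_finite_field_gt_1[where 'f = 'f]
  by (simp add: linearized_def coeff_sum power_inject_exp)

lemma poly_linearized:
  "poly (linearized n c) x = (\<Sum>k<n. c k * (x :: 'f::finite_field alg_closure) ^ (CARD('f) ^ k))"
  by (simp add: linearized_def poly_sum poly_monom)

lemma degree_linearized: "degree (linearized n c :: 'f::finite_field alg_closure poly) < CARD('f) ^ n"
proof -
  have "0 < CARD('f) ^ n" by simp
  then show ?thesis
    unfolding linearized_def
    using card_finite_field_gt_1[where 'f = 'f]
    by (intro degree_sum_less) (auto intro: le_less_trans[OF degree_monom_le])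
qed

text \<open>The field as a module over the polynomial ring, with the variable acting as Frobenius.\<close>

definition frob_act :: "'f::finite_field poly \<Rightarrow> 'f alg_closure \<Rightarrow> 'f alg_closure" where
  "frob_act h v = (\<Sum>i\<le>degree h. to_ac (coeff h i) * v ^ (CARD('f) ^ i))"

lemma frob_act_eq_sum:
  fixes h :: "'f::finite_field poly"
  assumes "degree h \<le> n"
  shows "frob_act h v = (\<Sum>i\<le>n. to_ac (coeff h i) * v ^ (CARD('f) ^ i))"
  unfolding frob_act_def using assms
  by (intro sum.mono_neutral_left) (auto simp: coeff_eq_0)

lemma frob_act_0 [simp]: "frob_act 0 v = 0"
  by (simp add: frob_act_def)

lemma frob_act_pCons:
  "frob_act (pCons c h) v = to_ac (c :: 'f::finite_field) * v + frob_act h (v ^ CARD('f))"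
  using degree_pCons_le[of c h]
  by (simp add: frob_act_eq_sum[of "pCons c h" "Suc (degree h)"] frob_act_def sum.atMost_Suc_shift
      power_mult del: sum.atMost_Suc)

lemma frob_act_add_left: "frob_act (g + h) v = frob_act g v + frob_act h v"
proof -
  let ?n = "max (degree g) (degree h)"
  have "degree (g + h) \<le> ?n" by (rule degree_add_le_max)
  then show ?thesis
    by (simp add: frob_act_eq_sum[of _ ?n] sum.distrib algebra_simps)
qed

lemma frob_act_diff_left: "frob_act (g - h) v = frob_act g v - frob_act h v"
  using frob_act_add_left[of "g - h" h v] by (simp add: algebra_simps)

lemma frob_act_smult: "frob_act (smult c h) v = to_ac c * frob_act h v"
  unfolding frob_act_eq_sum[OF degree_smult_le] frob_act_def[of h]
  by (simp only: sum_distrib_left coeff_smult to_ac_mult mult.assoc)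

lemma frob_act_monom: "frob_act (monom c k) v = to_ac (c :: 'f::finite_field) * v ^ (CARD('f) ^ k)"
  by (induction k arbitrary: v) (simp_all add: monom_0 monom_Suc frob_act_pCons power_mult)

lemma frob_act_sum: "frob_act (sum h A) v = (\<Sum>i\<in>A. frob_act (h i) v)"
  by (induction A rule: infinite_finite_induct) (simp_all add: frob_act_add_left)

lemma frob_act_add: "frob_act h (v + w) = frob_act h v + frob_act h w"
  by (simp add: frob_act_def frobenius_add sum.distrib algebra_simps)

lemma frob_act_zero [simp]: "frob_act h 0 = 0"
  by (metis frob_act_add add_0 add_cancel_right_right)

lemma frob_act_frobenius:
  fixes v :: "'f::finite_field alg_closure"
  shows "frob_act h (v ^ CARD('f)) = frob_act h v ^ CARD('f)"
  by (simp add: frob_act_def power_mult_distrib frobenius_sum[where k = 1, simplified]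
      to_ac_frobenius[where k = 1, simplified] mult.commute flip: power_mult)

text \<open>The module law. It holds because base field coefficients are fixed by Frobenius, so that
  \<open>frob_act h\<close> commutes with Frobenius.\<close>

lemma frob_act_mult: "frob_act (g * h) v = frob_act g (frob_act h v)"
  by (induction g arbitrary: v)
    (simp_all add: frob_act_pCons frob_act_add_left frob_act_smult frob_act_frobenius)

lemma frob_act_dvd: "g dvd h \<Longrightarrow> frob_act g v = 0 \<Longrightarrow> frob_act h v = 0"
  by (metis dvdE frob_act_mult frob_act_zero mult.commute)

lemma frob_act_GF: "v \<in> GF m \<Longrightarrow> frob_act h v \<in> GF m"
  unfolding frob_act_def by (intro GF_sum GF_mult GF_to_ac GF_power)

text \<open>Annihilators are ideals of a principal ideal domain: by division with remainder, a
  nonzero element of least degree generates.\<close>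

lemma annihilator_generator:
  fixes v :: "'f::finite_field alg_closure"
  assumes "v \<in> GF m" "m \<ge> 1"
  obtains d where "d \<noteq> 0" "degree d \<le> m" "\<And>h. frob_act h v = 0 \<longleftrightarrow> d dvd h"
proof -
  define P where "P d \<longleftrightarrow> d \<noteq> 0 \<and> frob_act d v = 0" for d
  \<comment> \<open>x^m - 1 annihilates all of \<open>GF m\<close>; it is the source of the degree
    bound.\<close>
  define f :: "'f poly" where "f = monom 1 m - 1"
  have "coeff f m = 1"
    using assms(2) by (simp add: f_def)
  moreover have "frob_act f v = 0"
    using frob_act_monom[of 1 0 v]
    by (simp add: f_def frob_act_monom frob_act_diff_left GF_frobenius[OF assms(1)])
  moreover have "degree f \<le> m"
    unfolding f_def by (intro degree_diff_le degree_monom_le) simp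
  ultimately have f: "P f" "degree f \<le> m"
    by (auto simp: P_def)
  define d where "d = arg_min degree P"
  have d: "P d" "\<And>h. P h \<Longrightarrow> degree d \<le> degree h"
    using arg_min_nat_lemma[of P f degree] f(1) by (auto simp: d_def)
  have "d dvd h" if "frob_act h v = 0" for h
  proof -
    have "frob_act (h mod d) v = 0"
      using that d(1) frob_act_diff_left[of h "(h div d) * d" v]
      by (simp add: P_def frob_act_mult minus_div_mult_eq_mod)
    then have "h mod d = 0"
      using d(1) d(2)[of "h mod d"] degree_mod_less[of d h] unfolding P_def by (meson not_le)
    then show ?thesis by auto
  qed
  then show thesis
    using that[of d] d(1) d(2)[OF f(1)] f(2) frob_act_dvd[of d _ v] unfolding P_def
    by (meson order_trans)
qed

section \<open>Prime powers dividing a polynomial\<close>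

lemma exists_irreducible_dvd:
  fixes e :: "'a::field poly"
  assumes "degree e > 0"
  shows "\<exists>p. irreducible p \<and> p dvd e"
  using assms
proof (induction "degree e" arbitrary: e rule: less_induct)
  case less
  show ?case
  proof (cases "irreducible e")
    case False
    then obtain a b where ab: "e = a * b" "\<not> a dvd 1" "\<not> b dvd 1"
      using less.prems is_unit_iff_degree[of e] unfolding irreducible_def by fastforce
    then have "a \<noteq> 0" "b \<noteq> 0"
      using less.prems by auto
    with ab have "degree a > 0" "degree a < degree e"
      by (auto simp: is_unit_iff_degree degree_mult_eq)
    then show ?thesis
      using less.hyps[of a] ab(1) by (meson dvd_mult2)
  qed auto
qed

text \<open>If an irreducible factor p of e also divides d, it is cancelled from both. Undoing the
  cancellation raises the exponent k by one if the irreducible polynomial found is associated to p,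
  and leaves it alone otherwise.\<close>

lemma not_dvd_imp_prime_power_dvd:
  fixes d e :: "'a::field poly"
  assumes "e \<noteq> 0" "d \<noteq> 0" "\<not> e dvd d"
  shows "\<exists>p k. irreducible p \<and> p ^ k dvd e \<and> \<not> p ^ k dvd d"
  using assms
proof (induction "degree e" arbitrary: e d rule: less_induct)
  case less
  have "degree e > 0"
    using less.prems is_unit_iff_degree[of e] unit_imp_dvd by blast
  then obtain p where p: "irreducible p" "p dvd e"
    using exists_irreducible_dvd by blast
  show ?case
  proof (cases "p dvd d")
    case False
    then show ?thesis
      using p by (intro exI[of _ p] exI[of _ 1]) auto
  next
    case True
    obtain d' e' where de: "d = p * d'" "e = p * e'"
      using True p(2) by blast
    have "p \<noteq> 0" "e' \<noteq> 0" "d' \<noteq> 0" "\<not> e' dvd d'"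
      using less.prems de by auto
    moreover have "degree p > 0"
      using p(1) \<open>p \<noteq> 0\<close> is_unit_iff_degree[of p] irreducible_not_unit by blast
    ultimately obtain p' k where p': "irreducible p'" "p' ^ k dvd e'" "\<not> p' ^ k dvd d'"
      using less.hyps[of e' d'] de(2) by (auto simp: degree_mult_eq)
    show ?thesis
    proof (cases "p' dvd p")
      case True
      then obtain c where c: "p = p' * c" by blast
      with p(1) p'(1) have "c dvd 1"
        using irreducibleD irreducible_not_unit by blast
      have "p' ^ Suc k dvd e"
        using p'(2) c by (auto simp: de(2) intro: mult_dvd_mono)
      moreover have "\<not> p' ^ Suc k dvd d"
      proof
        assume "p' ^ Suc k dvd d"
        then have "p' * p' ^ k dvd p' * (c * d')"
          by (simp add: de(1) c mult_ac)
        moreover have "p' \<noteq> 0" using p'(1) by auto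
        ultimately have "p' ^ k dvd c * d'"
          using dvd_times_left_cancel_iff by blast
        then show False
          using p'(3) \<open>c dvd 1\<close> by (simp add: dvd_mult_unit_iff')
      qed
      ultimately show ?thesis using p'(1) by blast
    next
      case False
      have "\<not> p' ^ k dvd d"
      proof
        assume "p' ^ k dvd d"
        then have "p' ^ k dvd p * d'" by (simp add: de(1))
        then have "p' ^ k dvd d'"
          using prime_power_dvd_multD[of p' k p d'] False field_poly_irreducible_imp_prime[OF p'(1)]
          by (cases "k = 0") auto
        then show False using p'(3) by simp
      qed
      then show ?thesis
        using p'(1,2) de(2) by (meson dvd_mult)
    qed
  qed
qed


lemma prime_power_dvd_mult_cancel:
  fixes p :: "'a::field poly"
  assumes "irreducible p" "\<not> p dvd a" "p ^ k dvd a * b"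
  shows "p ^ k dvd b"
  using assms prime_power_dvd_multD[OF field_poly_irreducible_imp_prime] by (cases "k = 0") auto

lemma split_off_power:
  fixes d p :: "'a::field poly"
  assumes "d \<noteq> 0" "degree p > 0"
  shows "\<exists>j d'. d = p ^ j * d' \<and> \<not> p dvd d'"
  using assms(1)
proof (induction "degree d" arbitrary: d rule: less_induct)
  case less
  show ?case
  proof (cases "p dvd d")
    case True
    then obtain c where c: "d = p * c" by blast
    with less.prems assms(2) have "degree c < degree d" "c \<noteq> 0"
      by (auto simp: degree_mult_eq)
    then obtain j d' where "c = p ^ j * d'" "\<not> p dvd d'"
      using less.hyps by blast
    then show ?thesis
      using c by (intro exI[of _ "Suc j"] exI[of _ d']) (simp add: mult.assoc)
  next
    case False
    then show ?thesis by (intro exI[of _ 0] exI[of _ d]) simp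
  qed
qed

text \<open>
  A vector whose annihilator has maximal degree generates the whole module: otherwise the
  annihilator of some other vector contains a higher power of an irreducible polynomial, and a
  combination of the two vectors has a larger annihilator.
\<close>

theorem normal_element:
  assumes "m \<ge> 1"
  obtains \<beta> :: "'f::finite_field alg_closure"
  where "\<beta> \<in> GF m" "\<And>h. degree h < m \<Longrightarrow> frob_act h \<beta> = 0 \<Longrightarrow> h = 0"
proof -
  define P where "P v d \<longleftrightarrow> v \<in> GF m \<and> d \<noteq> 0 \<and> degree d \<le> m \<and> (\<forall>h. frob_act h v = 0 \<longleftrightarrow> d dvd h)"
    for v :: "'f alg_closure" and d
  have ex: "\<exists>d. P v d" if "v \<in> GF m" for v
    using annihilator_generator[OF that assms] that unfolding P_def by metis
  define N where "N = {n. \<exists>v d. P v d \<and> degree d = n}"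
  have "N \<subseteq> {..m}"
    by (auto simp: N_def P_def)
  then have fin: "finite N"
    by (rule finite_subset) simp
  moreover have "N \<noteq> {}"
    using ex[of 0] by (auto simp: N_def)
  ultimately obtain v d where vd: "P v d" "degree d = Max N"
    using Max_in[of N] by (auto simp: N_def)
  have max: "degree e \<le> degree d" if "P w e" for w e
    unfolding vd(2) using that fin by (intro Max_ge) (auto simp: N_def)
  have "degree d = m"
  proof (rule ccontr)
    assume "degree d \<noteq> m"
    then have deg: "degree d < m"
      using vd(1) by (auto simp: P_def)
    have d0: "d \<noteq> 0"
      using vd(1) by (simp add: P_def)
    \<comment> \<open>If d killed all of \<open>GF m\<close>, the linearized polynomial with the
      coefficients of d would have q^m roots but smaller degree.\<close>
    obtain u where u: "u \<in> GF m" "frob_act d u \<noteq> 0"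
    proof (rule ccontr)
      assume "\<not> thesis"
      then have zero: "frob_act d u = 0" if "u \<in> GF m" for u
        using that \<open>\<And>u. u \<in> GF m \<Longrightarrow> frob_act d u \<noteq> 0 \<Longrightarrow> thesis\<close> by blast
      let ?a = "linearized m (\<lambda>k. to_ac (coeff d k))"
      have "poly ?a x = frob_act d x" for x
      proof -
        have "{..<m} = {..m - 1}" using assms by auto
        then show ?thesis
          using deg by (simp add: poly_linearized frob_act_eq_sum[of d "m - 1"])
      qed
      then have "?a = 0"
        using zero assms degree_linearized by (intro poly_eq_0_on_GF[of m]) auto
      then have "coeff ?a (CARD('f) ^ degree d) = 0"
        by simp
      then show False
        using deg d0 by (simp add: coeff_linearized)
    qed
    obtain e where e: "P u e"
      using ex u(1) by blast
    have "\<not> e dvd d" "e \<noteq> 0"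
      using u e by (auto simp: P_def)
    then obtain p k where p: "irreducible p" "p ^ k dvd e" "\<not> p ^ k dvd d"
      using not_dvd_imp_prime_power_dvd d0 by blast
    have "p \<noteq> 0" "\<not> p dvd 1"
      using p(1) by (auto simp: irreducible_def)
    then have degp: "degree p > 0"
      by (simp add: is_unit_iff_degree)
    obtain j d' where dj: "d = p ^ j * d'" and d': "\<not> p dvd d'"
      using split_off_power[OF d0 degp] by blast
    have jk: "j < k"
      using p(3) dj by (metis dvd_triv_left le_imp_power_dvd dvd_trans not_less)
    obtain e' where e': "e = p ^ k * e'"
      using p(2) by blast
    have "e' \<noteq> 0" "d' \<noteq> 0"
      using \<open>e \<noteq> 0\<close> d0 e' dj by auto
    \<comment> \<open>The annihilators of the two summands are generated by d' and p^k. These are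
      coprime, so the annihilator of the sum lies in the ideal of d' * p^k, whose degree exceeds
      that of d because j < k.\<close>
    define w where "w = frob_act (p ^ j) v + frob_act e' u"
    have v': "frob_act (h * p ^ j) v = 0 \<longleftrightarrow> d' dvd h" for h
      using vd(1) \<open>p \<noteq> 0\<close> by (simp add: P_def dj mult.commute)
    have u': "frob_act (h * e') u = 0 \<longleftrightarrow> p ^ k dvd h" for h
      using e \<open>e' \<noteq> 0\<close> by (simp add: P_def e')
    have "w \<in> GF m"
      using vd(1) u(1) by (auto simp: w_def P_def intro!: GF_add frob_act_GF)
    then obtain g where g: "P w g"
      using ex by blast
    then have "frob_act g w = 0"
      by (simp add: P_def)
    then have sum0: "frob_act (g * p ^ j) v + frob_act (g * e') u = 0"
      by (simp add: w_def frob_act_add frob_act_mult)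
    \<comment> \<open>Applying d' removes the part coming from v, which gives p^k dvd g; then the
      part coming from u vanishes in the original equation, which gives d' dvd g.\<close>
    then have "frob_act d' (frob_act (g * p ^ j) v) + frob_act d' (frob_act (g * e') u) = 0"
      by (simp flip: frob_act_add)
    moreover have "frob_act d' (frob_act (g * p ^ j) v) = 0"
      using v'[of "d' * g"] by (simp add: frob_act_mult mult.assoc)
    ultimately have "p ^ k dvd d' * g"
      using u'[of "d' * g"] by (simp add: frob_act_mult mult.assoc)
    then have pk: "p ^ k dvd g"
      using prime_power_dvd_mult_cancel[OF p(1) d'] by blast
    then have "frob_act (g * p ^ j) v = 0"
      using sum0 u'[of g] by simp
    then obtain t where t: "g = d' * t"
      using v'[of g] by blast
    then have "p ^ k dvd t"
      using pk prime_power_dvd_mult_cancel[OF p(1) d'] by blast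
    then have "d' * p ^ k dvd g"
      by (simp add: t)
    moreover have "g \<noteq> 0"
      using g by (simp add: P_def)
    ultimately have "degree (d' * p ^ k) \<le> degree g"
      by (rule dvd_imp_degree_le)
    moreover have "degree (d' * p ^ k) = degree d' + k * degree p"
      using \<open>d' \<noteq> 0\<close> \<open>p \<noteq> 0\<close> by (simp add: degree_mult_eq degree_power_eq)
    moreover have "degree d = degree d' + j * degree p"
      using \<open>d' \<noteq> 0\<close> \<open>p \<noteq> 0\<close> by (simp add: dj degree_mult_eq degree_power_eq)
    moreover have "j * degree p < k * degree p"
      using jk degp by simp
    ultimately show False
      using max[OF g] by simp
  qed
  then show thesis
    using that[of v] vd(1) dvd_imp_degree_le unfolding P_def by (metis not_less)
qed

text \<open>\<open>normal_element\<close> gives independence of the conjugates; spanning follows by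
  counting, as the q^m coefficient vectors have distinct images in a set of q^m elements.\<close>

corollary normal_basis:
  assumes "m \<ge> 1"
  obtains \<beta> :: "'f::finite_field alg_closure"
  where "\<beta> \<in> GF m" "\<And>x. x \<in> GF m \<Longrightarrow> \<exists>c. x = (\<Sum>i<m. to_ac (c i) * \<beta> ^ (CARD('f) ^ i))"
proof -
  obtain \<beta> :: "'f alg_closure"
    where \<beta>: "\<beta> \<in> GF m" "\<And>h. degree h < m \<Longrightarrow> frob_act h \<beta> = 0 \<Longrightarrow> h = 0"
    using normal_element[OF assms] by blast
  define F where "F c = (\<Sum>i<m. to_ac (c i) * \<beta> ^ (CARD('f) ^ i))" for c :: "nat \<Rightarrow> 'f"
  let ?C = "{..<m} \<rightarrow>\<^sub>E (UNIV :: 'f set)"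
  have "inj_on F ?C"
  proof (rule inj_onI)
    fix c c' assume c: "c \<in> ?C" "c' \<in> ?C" "F c = F c'"
    define h where "h = (\<Sum>i<m. monom (c i - c' i) i)"
    have "degree h < m"
      unfolding h_def using assms
      by (intro degree_sum_less) (auto intro: le_less_trans[OF degree_monom_le])
    moreover have "frob_act h \<beta> = 0"
      using c(3) by (simp add: h_def frob_act_sum frob_act_monom F_def sum_subtractf algebra_simps)
    ultimately have "h = 0"
      using \<beta>(2) by blast
    then have "coeff h i = 0" for i by simp
    moreover have "coeff h i = c i - c' i" if "i < m" for i
      using that by (simp add: h_def coeff_sum)
    ultimately have "c i = c' i" if "i < m" for i
      using that by simp
    then show "c = c'"
      using c(1,2) by (intro PiE_ext) auto
  qed
  then have "card (F ` ?C) = CARD('f) ^ m"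
    by (simp add: card_image card_PiE)
  moreover have "F ` ?C \<subseteq> GF m"
    unfolding F_def by (intro image_subsetI GF_sum GF_mult GF_to_ac GF_power \<beta>(1))
  ultimately have "F ` ?C = GF m"
    using finite_GF[OF assms] card_GF[OF assms, where 'f = 'f] by (intro card_subset_eq) auto
  then have "\<exists>c. x = F c" if "x \<in> GF m" for x
    using that by (metis imageE)
  then show thesis
    using that[of \<beta>] \<beta>(1) unfolding F_def by metis
qed

section \<open>Division of linearized polynomials\<close>

lemma lin_polys_0 [simp]: "0 \<in> lin_polys m"
  by (simp add: lin_polys_def)

lemma lin_polys_add: "a \<in> lin_polys m \<Longrightarrow> b \<in> lin_polys m \<Longrightarrow> a + b \<in> lin_polys m"
  unfolding lin_polys_def by (auto intro: GF_add) (metis add_0)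

lemma lin_polys_sum: "(\<And>i. i \<in> A \<Longrightarrow> f i \<in> lin_polys m) \<Longrightarrow> sum f A \<in> lin_polys m"
  by (induction A rule: infinite_finite_induct) (auto intro: lin_polys_add)

lemma lin_polys_monom:
  "c \<in> GF m \<Longrightarrow> monom c (CARD('f) ^ k) \<in> (lin_polys m :: 'f::finite_field alg_closure poly set)"
  by (auto simp: lin_polys_def)

lemma coeff_lin_polys_GF: "a \<in> lin_polys m \<Longrightarrow> coeff a n \<in> GF m"
  by (simp add: lin_polys_def)

lemma lin_polys_eq_linearized:
  fixes a :: "'f::finite_field alg_closure poly"
  assumes "a \<in> lin_polys m" "\<And>k. k \<ge> n \<Longrightarrow> coeff a (CARD('f) ^ k) = 0"
  shows "a = linearized n (\<lambda>k. coeff a (CARD('f) ^ k))"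
proof (rule poly_eqI)
  fix i
  show "coeff a i = coeff (linearized n (\<lambda>k. coeff a (CARD('f) ^ k))) i"
  proof (cases "\<exists>k. i = CARD('f) ^ k")
    case True
    then show ?thesis
      using assms(2) by (auto simp: coeff_linearized not_less)
  next
    case False
    then have "coeff a i = 0"
      using assms(1) by (auto simp: lin_polys_def)
    moreover have "coeff (linearized n (\<lambda>k. coeff a (CARD('f) ^ k))) i = 0"
      unfolding linearized_def coeff_sum using False by (intro sum.neutral) auto
    ultimately show ?thesis by simp
  qed
qed

lemma coeff_power_card_eq_0:
  fixes a :: "'f::finite_field alg_closure poly"
  assumes "k > degree a"
  shows "coeff a (CARD('f) ^ k) = 0"
proof -
  have "k < CARD('f) ^ k"
    using card_finite_field_gt_1[where 'f = 'f] by (simp add: power_gt_expt)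
  then show ?thesis
    using assms by (intro coeff_eq_0) simp
qed

text \<open>The summation bound is crude but sufficient: k < q^k, so a coefficient at q^k vanishes
  as soon as k exceeds the ordinary degree.\<close>

lemma lin_polys_expand:
  fixes a :: "'f::finite_field alg_closure poly"
  assumes "a \<in> lin_polys m"
  shows "a = (\<Sum>k<Suc (degree a). monom (coeff a (CARD('f) ^ k)) (CARD('f) ^ k))"
  using lin_polys_eq_linearized[OF assms, of "Suc (degree a)"] coeff_power_card_eq_0[of a]
  unfolding linearized_def by simp

lemma qdeg_less_iff:
  fixes a :: "'f::finite_field alg_closure poly"
  assumes "a \<in> lin_polys m"
  shows "qdeg a < ereal (real n) \<longleftrightarrow> (\<forall>k\<ge>n. coeff a (CARD('f) ^ k) = 0)"
proof (cases "a = 0")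
  case False
  let ?S = "{k. coeff a (CARD('f) ^ k) \<noteq> 0}"
  have "?S \<subseteq> {..degree a}"
    using coeff_power_card_eq_0[of a] by (auto simp: not_less[symmetric])
  then have "finite ?S"
    by (rule finite_subset) simp
  moreover have "?S \<noteq> {}"
    using False assms by (auto simp: lin_polys_def poly_eq_iff)
  ultimately have "Max ?S < n \<longleftrightarrow> (\<forall>k\<in>?S. k < n)"
    by (rule Max_less_iff)
  then show ?thesis
    using False by (auto simp: qdeg_def not_less[symmetric])
qed (simp add: qdeg_def)

section \<open>The modulus and right division by it\<close>

abbreviation modulus :: "nat \<Rightarrow> 'f::finite_field alg_closure poly" where
  "modulus m \<equiv> monom 1 (CARD('f) ^ m) - monom 1 1"

lemma qdeg_modulus:
  assumes "m \<ge> 1"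
  shows "qdeg (modulus m :: 'f::finite_field alg_closure poly) = ereal (real m)"
proof -
  have q: "1 < CARD('f)"
    by (rule card_finite_field_gt_1)
  have cf: "coeff (modulus m :: 'f alg_closure poly) (CARD('f) ^ k) \<noteq> 0 \<longleftrightarrow> k = 0 \<or> k = m" for k
  proof -
    have "CARD('f) ^ m = CARD('f) ^ k \<longleftrightarrow> m = k" "1 = CARD('f) ^ k \<longleftrightarrow> k = 0"
      using q power_inject_exp[of "CARD('f)" 0 k] by (auto simp: power_inject_exp)
    then show ?thesis
      using assms by (simp only: coeff_diff coeff_monom) auto
  qed
  then have "{k. coeff (modulus m :: 'f alg_closure poly) (CARD('f) ^ k) \<noteq> 0} = {0, m}"
    by auto
  moreover have "(modulus m :: 'f alg_closure poly) \<noteq> 0"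
    using cf[of 0] by (metis coeff_0)
  ultimately show ?thesis
    unfolding qdeg_def by (simp add: max_def)
qed

lemma smult_sum_right: "smult c (sum f A) = (\<Sum>i\<in>A. smult c (f i))"
  by (induction A rule: infinite_finite_induct) (simp_all add: smult_add_right)

lemma pcompose_monom: "monom c n \<circ>\<^sub>p b = smult c (b ^ n)"
  for b :: "'a::comm_semiring_1 poly"
  by (induction n) (simp_all add: monom_0 monom_Suc pcompose_pCons)

lemma lin_polys_pcompose:
  fixes a b :: "'f::finite_field alg_closure poly"
  assumes "a \<in> lin_polys m" "b \<in> lin_polys m"
  shows "a \<circ>\<^sub>p b \<in> lin_polys m"
proof -
  have "monom c (CARD('f) ^ k) \<circ>\<^sub>p b \<in> lin_polys m" if "c \<in> GF m" for c k
  proof -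
    have "b ^ CARD('f) ^ k =
        (\<Sum>j<Suc (degree b). monom (coeff b (CARD('f) ^ j) ^ CARD('f) ^ k) (CARD('f) ^ (j + k)))"
      by (subst lin_polys_expand[OF assms(2)], subst frobenius_sum_poly)
        (simp add: monom_power power_add)
    then have "monom c (CARD('f) ^ k) \<circ>\<^sub>p b =
        (\<Sum>j<Suc (degree b). monom (c * coeff b (CARD('f) ^ j) ^ CARD('f) ^ k) (CARD('f) ^ (j + k)))"
      by (simp add: pcompose_monom smult_sum_right smult_monom del: sum.lessThan_Suc)
    also have "\<dots> \<in> lin_polys m"
      using that coeff_lin_polys_GF[OF assms(2)]
      by (intro lin_polys_sum lin_polys_monom GF_mult GF_power)
    finally show ?thesis .
  qed
  then show ?thesis
    using coeff_lin_polys_GF[OF assms(1)]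
    by (subst lin_polys_expand[OF assms(1)]) (auto simp: pcompose_sum intro!: lin_polys_sum lin_polys_add simp del: sum.lessThan_Suc)
qed

lemma modulus_power:
  "(modulus m :: 'f::finite_field alg_closure poly) ^ (CARD('f) ^ k) =
     monom 1 (CARD('f) ^ (m + k)) - monom 1 (CARD('f) ^ k)"
proof -
  have "(modulus m + monom 1 1 :: 'f alg_closure poly) ^ (CARD('f) ^ k) =
      modulus m ^ (CARD('f) ^ k) + monom 1 1 ^ (CARD('f) ^ k)"
    using frobenius_sum_poly[of "\<lambda>b. if b then modulus m else monom 1 1" UNIV k]
    by (simp add: UNIV_bool add.commute)
  then show ?thesis
    by (simp add: monom_power power_add algebra_simps)
qed

text \<open>By additivity only monomials matter. For k \<ge> m, composing the monomial of q-degree k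
  - m with the modulus yields the monomial of q-degree k minus that of q-degree k - m, so the
  induction goes down by m.\<close>

lemma right_division_exists:
  fixes a :: "'f::finite_field alg_closure poly"
  assumes "a \<in> lin_polys m" "m \<ge> 1"
  shows "\<exists>d\<in>lin_polys m. \<exists>r\<in>lin_polys m.
    (\<forall>k\<ge>m. coeff r (CARD('f) ^ k) = 0) \<and> a = d \<circ>\<^sub>p modulus m + r" (is "?P a")
proof -
  have add: "?P (a + b)" if ab: "?P a" "?P b" for a b :: "'f alg_closure poly"
  proof -
    obtain d r d' r' where
      "d \<in> lin_polys m" "r \<in> lin_polys m" "\<forall>k\<ge>m. coeff r (CARD('f) ^ k) = 0" "a = d \<circ>\<^sub>p modulus m + r"
      "d' \<in> lin_polys m" "r' \<in> lin_polys m" "\<forall>k\<ge>m. coeff r' (CARD('f) ^ k) = 0" "b = d' \<circ>\<^sub>p modulus m + r'"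
      using ab by blast
    then show ?thesis
      by (intro bexI[of _ "d + d'"] bexI[of _ "r + r'"]) (auto simp: pcompose_add intro: lin_polys_add)
  qed
  have monom: "?P (monom c (CARD('f) ^ k))" if "c \<in> GF m" for c :: "'f alg_closure" and k
  proof (induction k rule: less_induct)
    case (less k)
    show ?case
    proof (cases "k < m")
      case True
      then show ?thesis
        using that card_finite_field_gt_1[where 'f = 'f]
        by (intro bexI[of _ 0] bexI[of _ "monom c (CARD('f) ^ k)"]) (auto intro: lin_polys_monom)
    next
      case False
      let ?t = "monom c (CARD('f) ^ (k - m))"
      have "?P (?t \<circ>\<^sub>p modulus m)"
        using that by (intro bexI[of _ ?t] bexI[of _ 0]) (auto intro: lin_polys_monom)
      moreover have "?P ?t"
        using False assms(2) by (intro less) simp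
      ultimately have "?P (?t \<circ>\<^sub>p modulus m + ?t)"
        by (rule add)
      moreover have "?t \<circ>\<^sub>p modulus m + ?t = monom c (CARD('f) ^ k)"
        unfolding pcompose_monom modulus_power using False by (simp add: smult_diff_right smult_monom)
      ultimately show ?thesis by simp
    qed
  qed
  have zero: "?P 0"
    by (intro bexI[of _ 0]) auto
  have "?P (\<Sum>k<n. monom (coeff a (CARD('f) ^ k)) (CARD('f) ^ k))" for n
  proof (induction n)
    case (Suc n)
    then show ?case
      unfolding sum.lessThan_Suc by (rule add[OF _ monom[OF coeff_lin_polys_GF[OF assms(1)]]])
  qed (use zero in simp)
  then show ?thesis
    using lin_polys_expand[OF assms(1)] by metis
qed

text \<open>The modulus vanishes on \<open>GF m\<close>, and a linearized polynomial has no constant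
  term because 0 is not a power of q.\<close>

lemma poly_pcompose_modulus:
  assumes "d \<in> lin_polys m" "x \<in> GF m"
  shows "poly (d \<circ>\<^sub>p modulus m) x = 0"
proof -
  have "coeff d 0 = 0"
    using assms(1) by (auto simp: lin_polys_def)
  then show ?thesis
    using assms(2) by (simp add: poly_pcompose poly_monom GF_def poly_0_coeff_0)
qed

text \<open>Two remainders have degree below q^m and the same values on \<open>GF m\<close>, so they
  coincide and the description in \<open>right_rem\<close> is proper. The remainder is thus known
  from values, without carrying out a division.\<close>

lemma
  fixes a :: "'f::finite_field alg_closure poly"
  assumes a: "a \<in> lin_polys m" and m: "m \<ge> 1"
  defines "r \<equiv> right_rem m a (modulus m)"
  shows right_rem_lin_polys: "r \<in> lin_polys m"
    and coeff_right_rem: "\<And>k. k \<ge> m \<Longrightarrow> coeff r (CARD('f) ^ k) = 0"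
    and poly_right_rem: "\<And>x. x \<in> GF m \<Longrightarrow> poly r x = poly a x"
proof -
  let ?P = "\<lambda>r. r \<in> lin_polys m \<and> qdeg r < qdeg (modulus m :: 'f alg_closure poly) \<and>
                  (\<exists>d\<in>lin_polys m. a = d \<circ>\<^sub>p modulus m + r)"
  have deg: "degree r < CARD('f) ^ m" if "?P r" for r
    using that lin_polys_eq_linearized[of r m m] degree_linearized[of m, where 'f = 'f]
    unfolding qdeg_modulus[OF m] by (metis qdeg_less_iff)
  have eval: "poly r x = poly a x" if "?P r" "x \<in> GF m" for r x
    using that poly_pcompose_modulus by auto
  have "\<exists>!r. ?P r"
  proof (rule ex_ex1I)
    show "\<exists>r. ?P r"
      using right_division_exists[OF a m] unfolding qdeg_modulus[OF m] by (metis qdeg_less_iff)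
    show "r = r'" if "?P r" "?P r'" for r r'
    proof -
      have "r - r' = 0"
        using deg[OF that(1)] deg[OF that(2)] eval[OF that(1)] eval[OF that(2)]
        by (intro poly_eq_0_on_GF[OF m]) (auto intro: degree_diff_less)
      then show ?thesis by simp
    qed
  qed
  then have P: "?P r"
    unfolding r_def right_rem_def by (rule theI')
  then show "r \<in> lin_polys m" by blast
  show "poly r x = poly a x" if "x \<in> GF m" for x
    using eval[OF P that] .
  show "coeff r (CARD('f) ^ k) = 0" if "k \<ge> m" for k
    using P that unfolding qdeg_modulus[OF m] by (metis qdeg_less_iff)
qed

section \<open>Evaluation at a normal basis\<close>

text \<open>Frobenius is additive and fixes base field scalars. This linearity turns the evaluation
  of one polynomial at the values of another into a matrix product.\<close>

lemma sum_frobenius_linear: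
  fixes c :: "nat \<Rightarrow> 'f::finite_field alg_closure"
  shows "poly (linearized n c) (\<Sum>i\<in>A. to_ac (l i) * x i) =
    (\<Sum>i\<in>A. to_ac (l i) * poly (linearized n c) (x i))"
proof -
  have "poly (linearized n c) (\<Sum>i\<in>A. to_ac (l i) * x i) =
      (\<Sum>k<n. \<Sum>i\<in>A. to_ac (l i) * (c k * x i ^ (CARD('f) ^ k)))"
    by (simp add: poly_linearized frobenius_sum sum_distrib_left power_mult_distrib mult.left_commute)
  also have "\<dots> = (\<Sum>i\<in>A. to_ac (l i) * poly (linearized n c) (x i))"
    by (subst sum.swap) (simp add: poly_linearized sum_distrib_left)
  finally show ?thesis .
qed

text \<open>The entries of the evaluation matrix depend on the sum of the indices modulo m only, and
  the inverse of such a matrix is of the same kind: one vector \<open>\<gamma>\<close> that is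
  mapped to the first unit vector, extended periodically, yields all rows of the inverse by
  rotation.\<close>

theorem normal_basis_evaluation:
  assumes m: "m \<ge> 1"
  obtains \<beta> :: "'f::finite_field alg_closure" and h where "\<beta> \<in> GF m" "\<And>i. h i \<in> GF m"
    "\<And>x. x \<in> GF m \<Longrightarrow> \<exists>l. x = (\<Sum>i<m. to_ac (l i) * \<beta> ^ (CARD('f) ^ i))"
    "\<And>c j. j < m \<Longrightarrow> (\<Sum>k<m. h (j + k) * (\<Sum>i<m. \<beta> ^ (CARD('f) ^ (k + i)) * c i)) = c j"
proof -
  obtain \<beta> :: "'f alg_closure" where \<beta>: "\<beta> \<in> GF m"
    and span: "\<And>x. x \<in> GF m \<Longrightarrow> \<exists>l. x = (\<Sum>i<m. to_ac (l i) * \<beta> ^ (CARD('f) ^ i))"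
    using normal_basis[OF m] by blast
  define b where "b i = \<beta> ^ (CARD('f) ^ i)" for i
  have b_GF: "b i \<in> GF m" for i
    unfolding b_def by (rule GF_power[OF \<beta>])
  have b_mod: "b (i mod m) = b i" for i
    unfolding b_def by (rule GF_frobenius_mod[OF \<beta>])
  let ?C = "{..<m} \<rightarrow>\<^sub>E (GF m :: 'f alg_closure set)"
  define F where "F c = restrict (\<lambda>j. \<Sum>k<m. c k * b (j + k)) {..<m}" for c
  \<comment> \<open>\<open>F\<close> evaluates at the conjugates. A linearized polynomial that
    vanishes on them vanishes on their span, which is \<open>GF m\<close>.\<close>
  have "inj_on F ?C"
  proof (rule inj_onI)
    fix c c' assume c: "c \<in> ?C" "c' \<in> ?C" "F c = F c'"
    let ?a = "linearized m (\<lambda>k. c k - c' k)"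
    have zero: "poly ?a (b j) = 0" if "j < m" for j
    proof -
      have "poly ?a (b j) = (\<Sum>k<m. c k * b (j + k)) - (\<Sum>k<m. c' k * b (j + k))"
        by (simp add: poly_linearized b_def sum_subtractf left_diff_distrib power_add power_mult)
      also have "\<dots> = F c j - F c' j"
        using that by (simp add: F_def)
      finally show ?thesis using c(3) by simp
    qed
    have "?a = 0"
    proof (rule poly_eq_0_on_GF[OF m degree_linearized])
      fix x :: "'f alg_closure" assume "x \<in> GF m"
      then obtain l where "x = (\<Sum>i<m. to_ac (l i) * b i)"
        using span unfolding b_def by blast
      then show "poly ?a x = 0"
        using zero by (simp add: sum_frobenius_linear)
    qed
    then have "c k = c' k" if "k < m" for k
      using that coeff_linearized[of m "\<lambda>k. c k - c' k" k] by simp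
    then show "c = c'"
      using c(1,2) by (intro PiE_ext) auto
  qed
  moreover have "F ` ?C \<subseteq> ?C"
    unfolding F_def by (intro image_subsetI restrict_PiE_iff[THEN iffD2] ballI GF_sum GF_mult b_GF) auto
  moreover have "finite ?C"
    using finite_GF[OF m] by (intro finite_PiE) auto
  ultimately have "F ` ?C = ?C"
    by (simp add: endo_inj_surj)
  \<comment> \<open>An injective self-map of a finite set is onto, so the first unit vector has a
    preimage.\<close>
  moreover have "restrict (\<lambda>j. if j = 0 then 1 else 0) {..<m} \<in> ?C"
    by (intro restrict_PiE_iff[THEN iffD2]) auto
  ultimately have "restrict (\<lambda>j. if j = 0 then 1 else 0) {..<m} \<in> F ` ?C"
    by (simp only:)
  then obtain \<gamma> where \<gamma>: "\<gamma> \<in> ?C" "F \<gamma> = restrict (\<lambda>j. if j = 0 then 1 else 0) {..<m}"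
    by (elim imageE) simp
  have dual: "(\<Sum>k<m. \<gamma> k * b (s + k)) = (if m dvd s then 1 else 0)" for s
  proof -
    have "b (s + k) = b (s mod m + k)" for k
      by (metis b_mod mod_add_left_eq)
    then have "(\<Sum>k<m. \<gamma> k * b (s + k)) = F \<gamma> (s mod m)"
      using m by (simp add: F_def)
    then show ?thesis
      using m by (simp add: \<gamma>(2) dvd_eq_mod_eq_0)
  qed
  define h where "h i = \<gamma> (i mod m)" for i
  have h_GF: "h i \<in> GF m" for i
    using \<gamma>(1) m unfolding h_def by (auto simp: PiE_iff)
  have delta: "(\<Sum>k<m. h (j + k) * b (k + i)) = (if i = j then 1 else 0)" if ij: "i < m" "j < m" for i j
  proof -
    \<comment> \<open>Rotating the summation index by j turns \<open>h (j + k)\<close> into an entry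
      of \<open>\<gamma>\<close>; \<open>m - j + i\<close> represents i - j modulo m without going
      below zero.\<close>
    have "(\<Sum>k<m. h (j + k) * b (k + i)) = (\<Sum>k<m. \<gamma> k * b ((m - j + i) + k))"
    proof (rule sum.reindex_bij_witness[where i = "\<lambda>k. (k + (m - j)) mod m" and j = "\<lambda>k. (j + k) mod m"])
      fix k assume k: "k \<in> {..<m}"
      have "((j + k) mod m + (m - j)) mod m = (j + k + (m - j)) mod m"
        by (simp add: mod_simps)
      also have "j + k + (m - j) = k + m"
        using ij by simp
      finally show "((j + k) mod m + (m - j)) mod m = k"
        using k by simp
      show "(j + k) mod m \<in> {..<m}"
        using m by simp
      have "b ((m - j + i) + (j + k) mod m) = b (((m - j + i) + (j + k) mod m) mod m)"
        by (rule b_mod[symmetric])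
      also have "((m - j + i) + (j + k) mod m) mod m = ((m - j + i) + (j + k)) mod m"
        by (simp add: mod_simps)
      also have "(m - j + i) + (j + k) = (k + i) + m"
        using ij by simp
      also have "b (((k + i) + m) mod m) = b (k + i)"
        by (simp add: b_mod)
      finally show "\<gamma> ((j + k) mod m) * b ((m - j + i) + (j + k) mod m) = h (j + k) * b (k + i)"
        by (simp add: h_def)
    next
      fix k assume k: "k \<in> {..<m}"
      have "(j + (k + (m - j)) mod m) mod m = (j + (k + (m - j))) mod m"
        by (simp add: mod_simps)
      also have "j + (k + (m - j)) = k + m"
        using ij by simp
      finally show "(j + (k + (m - j)) mod m) mod m = k"
        using k by simp
      show "(k + (m - j)) mod m \<in> {..<m}"
        using m by simp
    qed
    also have "\<dots> = (if m dvd m - j + i then 1 else 0)"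
      by (rule dual)
    also have "m dvd m - j + i \<longleftrightarrow> i = j"
    proof
      assume "m dvd m - j + i"
      then obtain t where t: "m - j + i = m * t" by blast
      \<comment> \<open>\<open>m - j + i\<close> lies strictly between 0 and 2 * m.\<close>
      then have "t = 1"
        using ij by (cases t; cases "t - 1") auto
      then show "i = j" using t ij by simp
    qed (use ij in auto)
    finally show ?thesis .
  qed
  have "(\<Sum>k<m. h (j + k) * (\<Sum>i<m. \<beta> ^ (CARD('f) ^ (k + i)) * c i)) = c j" if j: "j < m" for c j
  proof -
    have "(\<Sum>k<m. h (j + k) * (\<Sum>i<m. b (k + i) * c i)) = (\<Sum>i<m. (\<Sum>k<m. h (j + k) * b (k + i)) * c i)"
      unfolding sum_distrib_left sum_distrib_right by (subst sum.swap) (simp add: mult.assoc)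
    also have "\<dots> = (\<Sum>i<m. (if i = j then 1 else 0) * c i)"
      using delta j by simp
    also have "\<dots> = c j"
      using j by (simp add: if_distrib[of "\<lambda>x. x * _"] sum.delta cong: if_cong)
    finally show ?thesis by (simp add: b_def)
  qed
  then show thesis
    using that[of \<beta> h] \<beta> h_GF span by blast
qed

section \<open>Interpolation\<close>

lemma coeff_mult_GF:
  assumes "\<And>i. coeff p i \<in> GF m" "\<And>i. coeff q i \<in> GF m"
  shows "coeff (p * q) i \<in> GF m"
  unfolding coeff_mult using assms by (intro GF_sum GF_mult)

lemma coeff_prod_GF:
  assumes "\<And>x i. x \<in> A \<Longrightarrow> coeff (f x) i \<in> GF m"
  shows "coeff (prod f A) i \<in> GF m"
  using assms
  by (induction A arbitrary: i rule: infinite_finite_induct) (auto intro!: coeff_mult_GF)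

text \<open>\<open>W l s\<close> is the coefficient of x^l in the s-th Lagrange polynomial, so
  \<open>W\<close> is the inverse of the Vandermonde matrix of the points. Its entries lie in
  \<open>GF m\<close> and can serve as constants of a program.\<close>

lemma interpolation_weights:
  fixes e :: "nat \<Rightarrow> 'f::finite_field alg_closure"
  assumes inj: "inj_on e {..<n}" and GF: "\<And>i. i < n \<Longrightarrow> e i \<in> GF m"
  obtains W where "\<And>l s. s < n \<Longrightarrow> W l s \<in> GF m"
    "\<And>l j. l < n \<Longrightarrow> j < n \<Longrightarrow> (\<Sum>s<n. W l s * e s ^ j) = (if l = j then 1 else 0)"
proof -
  define L where "L i = (\<Prod>k\<in>{..<n} - {i}. smult (1 / (e i - e k)) [:- e k, 1:])" for i
  have L: "poly (L i) (e j) = (if i = j then 1 else 0)" if "i < n" "j < n" for i j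
  proof (cases "i = j")
    case True
    have "poly (smult (1 / (e i - e k)) [:- e k, 1:]) (e i) = 1" if "k \<in> {..<n} - {i}" for k
    proof -
      have "e i - e k \<noteq> 0"
        using inj that \<open>i < n\<close> by (auto simp: inj_on_def)
      moreover have "poly (smult c [:- e k, 1:]) (e i) = c * (e i - e k)" for c
        by (simp add: algebra_simps)
      moreover have "1 / d * d = 1" if "d \<noteq> 0" for d :: "'f alg_closure"
        using that by simp
      ultimately show ?thesis by metis
    qed
    then have "poly (L i) (e j) = (\<Prod>k\<in>{..<n} - {i}. 1)"
      using True unfolding L_def poly_prod by (intro prod.cong) auto
    then show ?thesis using True by simp
  next
    case False
    then show ?thesis
      using that unfolding L_def poly_prod by (auto intro!: prod_zero bexI[of _ j])
  qed
  have degL: "degree (L i) < n" if "i < n" for i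
  proof -
    have "degree (L i) \<le> (\<Sum>k\<in>{..<n} - {i}. 1)"
      unfolding L_def
      by (intro degree_prod_sum_le[THEN order_trans] sum_mono) (auto intro: order_trans[OF degree_smult_le])
    also have "\<dots> < n" using that by simp
    finally show ?thesis .
  qed
  have "coeff (L i) l \<in> GF m" if "i < n" for i l
    unfolding L_def
  proof (intro coeff_prod_GF)
    fix k j assume "k \<in> {..<n} - {i}"
    then have "e i - e k \<in> GF m" "- e k \<in> GF m"
      using GF that by auto
    moreover have "coeff [:- e k, 1:] j = (if j = 0 then - e k else if j = 1 then 1 else 0)"
      by (auto simp: coeff_pCons split: nat.splits)
    ultimately show "coeff (smult (1 / (e i - e k)) [:- e k, 1:]) j \<in> GF m"
      unfolding coeff_smult by (intro GF_mult GF_divide) auto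
  qed
  moreover have "(\<Sum>s<n. coeff (L s) l * e s ^ j) = (if l = j then 1 else 0)" if "l < n" "j < n" for l j
  proof -
    \<comment> \<open>\<open>?p\<close> interpolates the monomial \<open>?q\<close>: both have
      degree below n and agree at n points, so their coefficients at x^l agree.\<close>
    let ?p = "\<Sum>s<n. smult (e s ^ j) (L s)" and ?q = "monom 1 j :: 'f alg_closure poly"
    have "degree ?p < n"
      using that degL by (intro degree_sum_less) (auto intro: le_less_trans[OF degree_smult_le])
    then have "degree (?p - ?q) < n"
      using that by (intro degree_diff_less) (auto simp: degree_monom_eq)
    moreover have "poly (?p - ?q) (e i) = 0" if "i < n" for i
    proof -
      have "poly ?p (e i) = (\<Sum>s<n. if s = i then e s ^ j else 0)"
        unfolding poly_sum poly_smult using L that by (intro sum.cong) auto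
      then show ?thesis
        using that by (simp add: poly_monom)
    qed
    ultimately have "?p - ?q = 0"
      using card_image[OF inj] by (intro poly_eqI_degree[of "e ` {..<n}"]) auto
    then have "coeff ?p l = coeff ?q l" by simp
    then show ?thesis
      by (simp add: coeff_sum mult.commute)
  qed
  ultimately show thesis
    using that[of "\<lambda>l s. coeff (L s) l"] by blast
qed

lemma sum_swap3:
  "(\<Sum>s\<in>A. \<Sum>i\<in>B. \<Sum>j\<in>C. f s i j) = (\<Sum>i\<in>B. \<Sum>j\<in>C. \<Sum>s\<in>A. f s i j)"
  by (rule trans[OF sum.swap]) (intro sum.cong refl sum.swap)

text \<open>With the blocks \<open>P i\<close> and \<open>Q j\<close> as coefficients, the product
  is a polynomial in Y of degree at most 2r - 2, which 2r - 1 values determine; the weights extract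
  the coefficient of \<open>Y ^ l\<close> from the values at the points \<open>e s\<close>.\<close>

lemma toom_cook_identity:
  fixes P Q :: "nat \<Rightarrow> 'a::comm_ring_1 poly"
  assumes W: "\<And>l j. l < n \<Longrightarrow> j < n \<Longrightarrow> (\<Sum>s<n. W l s * e s ^ j) = (if l = j then 1 else 0)"
    and n: "n = 2 * r - 1"
  shows "(\<Sum>i<r. Y ^ i * P i) * (\<Sum>j<r. Y ^ j * Q j) =
    (\<Sum>l<n. \<Sum>s<n. smult (W l s)
      (Y ^ l * ((\<Sum>i<r. smult (e s ^ i) (P i)) * (\<Sum>j<r. smult (e s ^ j) (Q j)))))"
proof -
  have "(\<Sum>s<n. smult (W l s)
      (Y ^ l * ((\<Sum>i<r. smult (e s ^ i) (P i)) * (\<Sum>j<r. smult (e s ^ j) (Q j))))) =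
      (\<Sum>i<r. \<Sum>j<r. if l = i + j then Y ^ l * (P i * Q j) else 0)" (is "?lhs = _") if "l < n" for l
  proof -
    have prod: "(\<Sum>i<r. smult (e s ^ i) (P i)) * (\<Sum>j<r. smult (e s ^ j) (Q j)) =
        (\<Sum>i<r. \<Sum>j<r. smult (e s ^ (i + j)) (P i * Q j))" for s
      unfolding sum_product by (intro sum.cong refl) (simp add: power_add mult.commute)
    have "?lhs = (\<Sum>s<n. \<Sum>i<r. \<Sum>j<r. smult (W l s * e s ^ (i + j)) (Y ^ l * (P i * Q j)))"
      unfolding prod unfolding sum_distrib_left smult_sum_right by (intro sum.cong refl) simp
    also have "\<dots> = (\<Sum>i<r. \<Sum>j<r. \<Sum>s<n. smult (W l s * e s ^ (i + j)) (Y ^ l * (P i * Q j)))"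
      by (rule sum_swap3)
    also have "\<dots> = (\<Sum>i<r. \<Sum>j<r. smult (\<Sum>s<n. W l s * e s ^ (i + j)) (Y ^ l * (P i * Q j)))"
      by (simp add: smult_sum)
    also have "\<dots> = (\<Sum>i<r. \<Sum>j<r. if l = i + j then Y ^ l * (P i * Q j) else 0)"
    proof (intro sum.cong refl)
      fix i j assume "i \<in> {..<r}" "j \<in> {..<r}"
      then have "i + j < n" using n by simp
      from W[OF that this]
      show "smult (\<Sum>s<n. W l s * e s ^ (i + j)) (Y ^ l * (P i * Q j)) =
          (if l = i + j then Y ^ l * (P i * Q j) else 0)"
        by simp
    qed
    finally show ?thesis .
  qed
  then have "(\<Sum>l<n. \<Sum>s<n. smult (W l s)
      (Y ^ l * ((\<Sum>i<r. smult (e s ^ i) (P i)) * (\<Sum>j<r. smult (e s ^ j) (Q j))))) =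
      (\<Sum>l<n. \<Sum>i<r. \<Sum>j<r. if l = i + j then Y ^ l * (P i * Q j) else 0)"
    by (rule sum.cong[OF refl]) simp
  also have "\<dots> = (\<Sum>i<r. \<Sum>j<r. \<Sum>l<n. if l = i + j then Y ^ l * (P i * Q j) else 0)"
    by (rule sum_swap3)
  also have "\<dots> = (\<Sum>i<r. \<Sum>j<r. Y ^ (i + j) * (P i * Q j))"
    using n by (intro sum.cong refl) (auto simp: sum.delta)
  also have "\<dots> = (\<Sum>i<r. Y ^ i * P i) * (\<Sum>j<r. Y ^ j * Q j)"
    by (simp add: sum_product power_add algebra_simps)
  finally show ?thesis by simp
qed

section \<open>Linear maps over the extension field\<close>

lemma length_concat_blocks:
  "(\<And>k. k < n \<Longrightarrow> length (w k) = l) \<Longrightarrow> length (concat (map w [0..<n])) = n * l"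
  by (induction n) auto

lemma nth_concat_blocks:
  assumes "\<And>k. k < n \<Longrightarrow> length (w k) = l" "k < n" "j < l"
  shows "concat (map w [0..<n]) ! (k * l + j) = w k ! j"
  using assms
proof (induction n)
  case (Suc n)
  have len: "length (concat (map w [0..<n])) = n * l"
    using Suc.prems(1) by (intro length_concat_blocks) simp
  show ?case
  proof (cases "k < n")
    case True
    then have "k * l + j < n * l"
      using mult_le_mono1[of "Suc k" n l] Suc.prems(3) by simp
    then show ?thesis
      using Suc True len by (simp add: nth_append)
  next
    case False
    then have "k = n" using Suc.prems(2) by simp
    then show ?thesis using len by (simp add: nth_append)
  qed
qed simp

lemma computable_within_block:
  assumes len: "\<And>x k. x \<in> D \<Longrightarrow> k < n \<Longrightarrow> length (w x k) = l" and k: "k < n"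
  shows "computable_within 0 D (\<lambda>x. concat (map (w x) [0..<n])) (\<lambda>x. w x k)"
proof (rule computable_within_cong[OF computable_within_select[where ks = "[k * l..<k * l + l]"]])
  have kl: "k * l + l \<le> n * l"
    using mult_le_mono1[of "Suc k" n l] k by simp
  then show "i < length (concat (map (w x) [0..<n]))" if "x \<in> D" "i \<in> set [k * l..<k * l + l]" for x i
    using that length_concat_blocks[of n "w x" l] len by simp
  show "w x k = map ((!) (concat (map (w x) [0..<n]))) [k * l..<k * l + l]" if "x \<in> D" for x
    using that len k nth_concat_blocks[of n "w x" l k] by (intro nth_equalityI) auto
qed simp

locale extension_arith =
  fixes m T :: nat and bs :: "'f::finite_field alg_closure list"
  assumes m: "m \<ge> 1" and basis: "is_basis m bs" and arith: "field_arith_within T m bs"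
begin

section \<open>Coordinates with respect to the basis\<close>

lemma distinct_basis: "distinct bs" and independent_basis: "ac.independent (set bs)"
  and span_basis: "ac.span (set bs) = GF m"
  using basis by (auto simp: is_basis_def)

lemma sum_coords:
  assumes "x \<in> GF m"
  shows "(\<Sum>i<length bs. to_ac (coords bs x ! i) * bs ! i) = x"
proof -
  have "(\<Sum>i<length bs. to_ac (coords bs x ! i) * bs ! i) =
      (\<Sum>i<length bs. to_ac (ac.representation (set bs) x (bs ! i)) * bs ! i)"
    by (simp add: coords_def)
  also have "\<dots> = (\<Sum>b\<in>set bs. to_ac (ac.representation (set bs) x b) * b)"
    using bij_betw_nth[OF distinct_basis refl refl] by (rule sum.reindex_bij_betw)
  also have "\<dots> = x"
    using assms independent_basis span_basis by (intro ac.sum_representation_eq) auto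
  finally show ?thesis .
qed

lemma coords_sum:
  assumes "\<And>i. i \<in> A \<Longrightarrow> x i \<in> GF m" "t < length bs"
  shows "coords bs (\<Sum>i\<in>A. to_ac (c i) * x i) ! t = (\<Sum>i\<in>A. c i * coords bs (x i) ! t)"
proof -
  have "ac.representation (set bs) (\<Sum>i\<in>A. to_ac (c i) * x i) =
      (\<lambda>b. \<Sum>i\<in>A. ac.representation (set bs) (to_ac (c i) * x i) b)"
    using assms(1) span_basis independent_basis by (intro ac.representation_sum) (auto intro: GF_mult)
  also have "\<dots> = (\<lambda>b. \<Sum>i\<in>A. c i * ac.representation (set bs) (x i) b)"
    using assms(1) span_basis independent_basis
    by (intro ext sum.cong refl) (simp add: ac.representation_scale)
  finally show ?thesis
    using assms(2) by (simp add: coords_def)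
qed

text \<open>The dimension is found by counting: coordinates biject \<open>GF m\<close>, with q^m
  elements, with the lists over the base field that are as long as the basis.\<close>

lemma length_basis: "length bs = m"
proof -
  let ?n = "length bs"
  let ?L = "{cs :: 'f list. set cs \<subseteq> UNIV \<and> length cs = ?n}"
  have "bij_betw (coords bs) (GF m) ?L"
  proof (rule bij_betwI[where g = "\<lambda>cs. \<Sum>i<?n. to_ac (cs ! i) * bs ! i"])
    show "coords bs \<in> GF m \<rightarrow> ?L"
      by (auto simp: coords_def)
    have bs_GF: "bs ! i \<in> GF m" if "i < ?n" for i
      using that ac.span_base[of "bs ! i" "set bs"] span_basis by auto
    then show "(\<lambda>cs. \<Sum>i<?n. to_ac (cs ! i) * bs ! i) \<in> ?L \<rightarrow> GF m"
      by (auto intro!: GF_sum GF_mult)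
    show "(\<Sum>i<?n. to_ac (coords bs x ! i) * bs ! i) = x" if "x \<in> GF m" for x
      using that by (rule sum_coords)
    show "coords bs (\<Sum>i<?n. to_ac (cs ! i) * bs ! i) = cs" if "cs \<in> ?L" for cs
    proof (rule nth_equalityI)
      fix t assume "t < length (coords bs (\<Sum>i<?n. to_ac (cs ! i) * bs ! i))"
      then have t: "t < ?n" by (simp add: coords_def)
      have "coords bs (\<Sum>i<?n. to_ac (cs ! i) * bs ! i) ! t = (\<Sum>i<?n. cs ! i * coords bs (bs ! i) ! t)"
        using bs_GF t by (intro coords_sum) auto
      also have "\<dots> = (\<Sum>i<?n. if i = t then cs ! i else 0)"
        using t distinct_basis independent_basis
        by (intro sum.cong refl) (auto simp: coords_def ac.representation_basis nth_eq_iff_index_eq)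
      also have "\<dots> = cs ! t"
        using t by simp
      finally show "coords bs (\<Sum>i<?n. to_ac (cs ! i) * bs ! i) ! t = cs ! t" .
    qed (use that in \<open>simp add: coords_def\<close>)
  qed
  then have "card (GF m :: 'f alg_closure set) = card ?L"
    by (rule bij_betw_same_card)
  then have "CARD('f) ^ m = CARD('f) ^ ?n"
    using card_GF[OF m, where 'f = 'f] card_lists_length_eq[of "UNIV :: 'f set" ?n] by simp
  then show ?thesis
    using card_finite_field_gt_1[where 'f = 'f] by (simp add: power_inject_exp)
qed

lemma length_coords [simp]: "length (coords bs x) = m"
  using length_basis by (simp add: coords_def)

text \<open>The layout is that of \<open>lin_coords\<close> and also the row-major layout of an n by
  m matrix over the base field, so changing between these views costs nothing.\<close>

definition enc :: "nat \<Rightarrow> (nat \<Rightarrow> 'f alg_closure) \<Rightarrow> 'f list" where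
  "enc n v = concat (map (\<lambda>k. coords bs (v k)) [0..<n])"

lemma length_enc [simp]: "length (enc n v) = n * m"
  unfolding enc_def by (rule length_concat_blocks) simp

lemma enc_cong: "(\<And>k. k < n \<Longrightarrow> v k = w k) \<Longrightarrow> enc n v = enc n w"
  unfolding enc_def by (intro arg_cong[of _ _ concat] map_cong) auto

lemma uniform_enc [intro]: "uniform D (\<lambda>x. enc n (v x))"
  by (rule uniformI) simp

lemma computable_within_nth:
  "k < n \<Longrightarrow> computable_within 0 D (\<lambda>x. enc n (v x)) (\<lambda>x. coords bs (v x k))"
  unfolding enc_def by (rule computable_within_block) auto

lemma computable_within_enc:
  assumes "uniform D inp" "\<And>k. k < n \<Longrightarrow> computable_within t D inp (\<lambda>x. coords bs (v x k))"
  shows "computable_within (n * t) D inp (\<lambda>x. enc n (v x))"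
  unfolding enc_def using assms by (rule computable_within_concat)

section \<open>Arithmetic on encoded field elements\<close>

lemma computable_within_add:
  assumes unif: "uniform D inp"
    and v: "computable_within s D inp (\<lambda>x. coords bs (v x))" "\<And>x. x \<in> D \<Longrightarrow> v x \<in> GF m"
    and w: "computable_within t D inp (\<lambda>x. coords bs (w x))" "\<And>x. x \<in> D \<Longrightarrow> w x \<in> GF m"
  shows "computable_within (s + t + T) D inp (\<lambda>x. coords bs (v x + w x))"
proof -
  have "computable_within T (GF m \<times> GF m) (\<lambda>(x, y). coords bs x @ coords bs y) (\<lambda>(x, y). coords bs (x + y))"
    using arith by (simp add: field_arith_within_def)
  from computable_within_instance[OF this, of D "\<lambda>x. (v x, w x)"]
  have "computable_within T D (\<lambda>x. coords bs (v x) @ coords bs (w x)) (\<lambda>x. coords bs (v x + w x))"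
    using v(2) w(2) by simp
  then show ?thesis
    by (rule computable_within_seq[OF unif computable_within_append[OF unif v(1) w(1)]])
qed

lemma computable_within_scale:
  assumes unif: "uniform D inp"
    and v: "computable_within s D inp (\<lambda>x. coords bs (v x))" "\<And>x. x \<in> D \<Longrightarrow> v x \<in> GF m"
    and c: "c \<in> GF m"
  shows "computable_within (s + T) D inp (\<lambda>x. coords bs (c * v x))"
proof -
  have "computable_within T (GF m \<times> GF m) (\<lambda>(x, y). coords bs x @ coords bs y) (\<lambda>(x, y). coords bs (x * y))"
    using arith by (simp add: field_arith_within_def)
  from computable_within_instance[OF this, of D "\<lambda>x. (c, v x)"]
  have "computable_within T D (\<lambda>x. coords bs c @ coords bs (v x)) (\<lambda>x. coords bs (c * v x))"
    using v(2) c by simp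
  moreover have "computable_within (0 + s) D inp (\<lambda>x. coords bs c @ coords bs (v x))"
    by (rule computable_within_append[OF unif computable_within_const[OF unif] v(1)])
  ultimately show ?thesis
    using computable_within_seq[OF unif] by fastforce
qed

text \<open>Each term costs one multiplication by a loaded constant and one addition, whence 2 * T;
  the elements to be combined must be readable for free.\<close>

lemma computable_within_lincomb:
  assumes unif: "uniform D inp" and fin: "finite A"
    and v: "\<And>i. i \<in> A \<Longrightarrow> computable_within 0 D inp (\<lambda>x. coords bs (v x i))"
      "\<And>x i. x \<in> D \<Longrightarrow> i \<in> A \<Longrightarrow> v x i \<in> GF m"
    and c: "\<And>i. i \<in> A \<Longrightarrow> c i \<in> GF m"
  shows "computable_within (card A * (2 * T)) D inp (\<lambda>x. coords bs (\<Sum>i\<in>A. c i * v x i))"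
  using fin v c
proof (induction A rule: finite_induct)
  case empty
  show ?case using computable_within_const[OF unif] by simp
next
  case (insert i A)
  have "computable_within ((0 + T) + card A * (2 * T) + T) D inp
      (\<lambda>x. coords bs (c i * v x i + (\<Sum>i\<in>A. c i * v x i)))"
    using insert.prems by (intro computable_within_add[OF unif] computable_within_scale[OF unif] insert.IH)
      (auto intro!: GF_mult GF_sum)
  then show ?case
    using insert.hyps by (simp add: algebra_simps)
qed

lemma computable_within_linear_map:
  assumes "\<And>x i. x \<in> D \<Longrightarrow> i < n \<Longrightarrow> v x i \<in> GF m" "\<And>i j. c j i \<in> GF m"
  shows "computable_within (n' * (n * (2 * T))) D (\<lambda>x. enc n (v x)) (\<lambda>x. enc n' (\<lambda>j. \<Sum>i<n. c j i * v x i))"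
proof (rule computable_within_enc)
  fix j
  have "computable_within (card {..<n} * (2 * T)) D (\<lambda>x. enc n (v x)) (\<lambda>x. coords bs (\<Sum>i<n. c j i * v x i))"
    using assms by (intro computable_within_lincomb) (auto intro: computable_within_nth)
  then show "computable_within (n * (2 * T)) D (\<lambda>x. enc n (v x)) (\<lambda>x. coords bs (\<Sum>i<n. c j i * v x i))"
    by simp
qed auto

end

section \<open>Fast multiplication by a constant polynomial\<close>

text \<open>The i-th digit of p in base x^d.\<close>

definition slice :: "nat \<Rightarrow> nat \<Rightarrow> 'a::zero poly \<Rightarrow> 'a poly" where
  "slice d i p = poly_cutoff d (poly_shift (i * d) p)"

lemma coeff_slice: "coeff (slice d i p) j = (if j < d then coeff p (i * d + j) else 0)"
  by (simp add: slice_def coeff_poly_cutoff coeff_poly_shift add.commute)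

lemma sum_slices:
  fixes p :: "'a::comm_ring_1 poly"
  assumes "\<And>i. i \<ge> r * d \<Longrightarrow> coeff p i = 0" "d > 0"
  shows "(\<Sum>i<r. monom 1 d ^ i * slice d i p) = p"
proof (rule poly_eqI)
  fix j
  have "coeff (monom 1 d ^ i * slice d i p) j = (if i = j div d then coeff p j else 0)" for i
  proof (cases "i = j div d")
    case True
    then have "\<not> j < d * i" "j - d * i < d" "i * d + (j - d * i) = j"
      using assms(2) by (auto simp: minus_mult_div_eq_mod mult.commute[of _ d] not_less)
    then show ?thesis
      unfolding True by (simp add: monom_power coeff_monom_mult coeff_slice)
  next
    case False
    have "\<not> (d * i \<le> j \<and> j - d * i < d)"
    proof
      assume "d * i \<le> j \<and> j - d * i < d"
      then have "j div d = i"
        by (intro div_nat_eqI) (auto simp: mult.commute)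
      then show False using False by simp
    qed
    then show ?thesis
      using False by (auto simp: monom_power coeff_monom_mult coeff_slice)
  qed
  then have "coeff (\<Sum>i<r. monom 1 d ^ i * slice d i p) j = (if j div d < r then coeff p j else 0)"
    by (simp add: coeff_sum)
  also have "\<dots> = coeff p j"
  proof (cases "j div d < r")
    case False
    then have "r * d \<le> j"
      using assms(2) by (simp add: not_less less_eq_div_iff_mult_less_eq)
    then show ?thesis using assms(1) False by simp
  qed simp
  finally show "coeff (\<Sum>i<r. monom 1 d ^ i * slice d i p) j = coeff p j" .
qed

context extension_arith
begin

definition polys :: "nat \<Rightarrow> 'f alg_closure poly set" where
  "polys n = {p. (\<forall>i. coeff p i \<in> GF m) \<and> (\<forall>i\<ge>n. coeff p i = 0)}"

lemma slices_combination:
  assumes "p \<in> polys (r * d)" "a \<in> GF m"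
  shows "(\<Sum>i<r. smult (a ^ i) (slice d i p)) \<in> polys d"
  using assms unfolding polys_def
  by (auto simp: coeff_sum coeff_slice intro!: GF_sum GF_mult GF_power)

lemma polys_mult:
  assumes "p \<in> polys n" "q \<in> polys k"
  shows "p * q \<in> polys (n + k)"
proof -
  have "coeff (p * q) i = 0" if "i \<ge> n + k" for i
    unfolding coeff_mult
  proof (intro sum.neutral ballI)
    fix j assume "j \<in> {..i}"
    then have "j \<ge> n \<or> i - j \<ge> k" using that by auto
    then show "coeff p j * coeff q (i - j) = 0"
      using assms by (auto simp: polys_def)
  qed
  then show ?thesis
    using assms by (auto simp: polys_def intro: coeff_mult_GF)
qed

text \<open>Evaluation combines r terms for each of the d coefficients at each of the N points. The
  constant factor is evaluated outside the program, but every point yields a different constant, so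
  \<open>IH\<close> speaks about all of \<open>polys d\<close>. Interpolation is termwise: each of
  the 2rd result coefficients sums over all N * N pairs of a power and a point. For fixed r this
  affects only the constant.\<close>

lemma toom_cook_step:
  fixes e :: "nat \<Rightarrow> 'f alg_closure"
  assumes N: "N = 2 * r - 1" and inj: "inj_on e {..<N}" and e: "\<And>i. i < N \<Longrightarrow> e i \<in> GF m" and d: "d > 0"
    and IH: "\<And>B. B \<in> polys d \<Longrightarrow>
      computable_within t (polys d) (\<lambda>p. enc d (coeff p)) (\<lambda>p. enc (2 * d) (coeff (p * B)))"
    and B: "B \<in> polys (r * d)"
  shows "computable_within (N * (d * (r * (2 * T)) + t) + 2 * (r * d) * (N * N * (2 * T))) (polys (r * d))
    (\<lambda>p. enc (r * d) (coeff p)) (\<lambda>p. enc (2 * (r * d)) (coeff (p * B)))"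
proof -
  obtain W where W_GF: "\<And>l s. s < N \<Longrightarrow> W l s \<in> GF m"
    and W: "\<And>l j. l < N \<Longrightarrow> j < N \<Longrightarrow> (\<Sum>s<N. W l s * e s ^ j) = (if l = j then 1 else 0)"
    using interpolation_weights[OF inj e] by blast
  let ?D = "polys (r * d)" and ?inp = "\<lambda>p. enc (r * d) (coeff p)"
  define ev where "ev s p = (\<Sum>i<r. smult (e s ^ i) (slice d i p))" for s p
  define R where "R p s = ev s p * ev s B" for p s
  have ev_polys: "ev s p \<in> polys d" if "s < N" "p \<in> ?D" for s p
    unfolding ev_def using that e by (intro slices_combination) auto
  then have R_polys: "R p s \<in> polys (2 * d)" if "s < N" "p \<in> ?D" for p s
    unfolding R_def using that B polys_mult[of "ev s p" d "ev s B" d] by (simp add: mult_2)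
  have prod: "p * B = (\<Sum>l<N. \<Sum>s<N. smult (W l s) (monom 1 d ^ l * R p s))" if "p \<in> ?D" for p
  proof -
    have "(\<Sum>i<r. monom 1 d ^ i * slice d i p) = p" "(\<Sum>i<r. monom 1 d ^ i * slice d i B) = B"
      using that B d by (auto intro!: sum_slices simp: polys_def)
    then show ?thesis
      using toom_cook_identity[OF W N, of "monom 1 d" "\<lambda>i. slice d i p" "\<lambda>i. slice d i B"]
      by (simp add: R_def ev_def)
  qed
  have "computable_within (d * (r * (2 * T)) + t) ?D ?inp (\<lambda>p. enc (2 * d) (coeff (R p s)))"
    if s: "s < N" for s
  proof (rule computable_within_seq)
    show "computable_within (d * (r * (2 * T))) ?D ?inp (\<lambda>p. enc d (coeff (ev s p)))"
    proof (rule computable_within_enc)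
      fix j assume j: "j < d"
      have "computable_within (card {..<r} * (2 * T)) ?D ?inp
          (\<lambda>p. coords bs (\<Sum>i<r. e s ^ i * coeff p (i * d + j)))"
      proof (rule computable_within_lincomb)
        fix i assume "i \<in> {..<r}"
        then have "i * d + j < r * d"
          using j mult_le_mono1[of "Suc i" r d] by simp
        then show "computable_within 0 ?D ?inp (\<lambda>p. coords bs (coeff p (i * d + j)))"
          by (rule computable_within_nth)
      qed (use e s in \<open>auto simp: polys_def\<close>)
      then show "computable_within (r * (2 * T)) ?D ?inp (\<lambda>p. coords bs (coeff (ev s p) j))"
        using j by (simp add: ev_def coeff_sum coeff_slice)
    qed auto
    show "computable_within t ?D (\<lambda>p. enc d (coeff (ev s p))) (\<lambda>p. enc (2 * d) (coeff (R p s)))"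
      unfolding R_def
      by (rule computable_within_instance[OF IH]) (use ev_polys s B in auto)
  qed auto
  then have products: "computable_within (N * (d * (r * (2 * T)) + t)) ?D ?inp
      (\<lambda>p. concat (map (\<lambda>s. enc (2 * d) (coeff (R p s))) [0..<N]))" (is "computable_within _ _ _ ?mid")
    by (intro computable_within_concat) auto
  have unif: "uniform ?D ?mid"
    by (rule uniformI) (simp add: length_concat_blocks)
  have "computable_within (2 * (r * d) * (N * N * (2 * T))) ?D ?mid
      (\<lambda>p. enc (2 * (r * d)) (\<lambda>i. \<Sum>(l, s)\<in>{..<N} \<times> {..<N}. W l s * coeff (monom 1 d ^ l * R p s) i))"
  proof (rule computable_within_enc[OF unif])
    fix i
    have "computable_within (card ({..<N} \<times> {..<N}) * (2 * T)) ?D ?mid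
        (\<lambda>p. coords bs (\<Sum>u\<in>{..<N} \<times> {..<N}. W (fst u) (snd u) * coeff (monom 1 d ^ fst u * R p (snd u)) i))"
    proof (rule computable_within_lincomb[OF unif])
      fix u assume "u \<in> {..<N} \<times> {..<N}"
      then have u: "snd u < N" by auto
      let ?j = "i - d * fst u"
      \<comment> \<open>Multiplication by a power of x only moves registers. Outside the 2 * d
        coefficients of the small product the constant 0 is read instead; the guard
        \<open>d * fst u \<le> i\<close> is there because the subtraction in \<open>?j\<close>
        truncates.\<close>
      have *: "coeff (monom 1 d ^ fst u * R p (snd u)) i =
          (if d * fst u \<le> i \<and> ?j < 2 * d then coeff (R p (snd u)) ?j else 0)" if "p \<in> ?D" for p
        using R_polys[OF u that] by (auto simp: monom_power coeff_monom_mult polys_def)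
      have "computable_within (0 + 0) ?D ?mid (\<lambda>p. coords bs (coeff (R p (snd u)) ?j))" if "?j < 2 * d"
        using that
        by (intro computable_within_seq[OF unif computable_within_block[OF _ u] computable_within_nth]) auto
      moreover have "computable_within 0 ?D ?mid (\<lambda>p. coords bs 0)"
        by (rule computable_within_const[OF unif])
      ultimately have "computable_within 0 ?D ?mid (\<lambda>p. coords bs
          (if d * fst u \<le> i \<and> ?j < 2 * d then coeff (R p (snd u)) ?j else 0))"
        by (cases "d * fst u \<le> i"; cases "?j < 2 * d") simp_all
      then show "computable_within 0 ?D ?mid (\<lambda>p. coords bs (coeff (monom 1 d ^ fst u * R p (snd u)) i))"
        by (rule computable_within_cong) (simp_all add: *)
      show "coeff (monom 1 d ^ fst u * R p (snd u)) i \<in> GF m" if "p \<in> ?D" for p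
        using R_polys[OF u that] by (auto simp: *[OF that] polys_def)
    qed (use W_GF in auto)
    then show "computable_within (N * N * (2 * T)) ?D ?mid
        (\<lambda>p. coords bs (\<Sum>(l, s)\<in>{..<N} \<times> {..<N}. W l s * coeff (monom 1 d ^ l * R p s) i))"
      by (simp add: case_prod_beta)
  qed
  then have "computable_within (2 * (r * d) * (N * N * (2 * T))) ?D ?mid
      (\<lambda>p. enc (2 * (r * d)) (coeff (p * B)))"
  proof (rule computable_within_cong)
    fix p assume "p \<in> ?D"
    then have "coeff (p * B) i = (\<Sum>l<N. \<Sum>s<N. W l s * coeff (monom 1 d ^ l * R p s) i)" for i
      by (simp only: prod coeff_sum coeff_smult)
    then have "coeff (p * B) i =
        (\<Sum>(l, s)\<in>{..<N} \<times> {..<N}. W l s * coeff (monom 1 d ^ l * R p s) i)" for i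
      by (simp only: sum.cartesian_product)
    then show "enc (2 * (r * d)) (coeff (p * B)) =
        enc (2 * (r * d)) (\<lambda>i. \<Sum>(l, s)\<in>{..<N} \<times> {..<N}. W l s * coeff (monom 1 d ^ l * R p s) i)"
      by (intro enc_cong)
  qed simp
  then show ?thesis
    by (rule computable_within_seq[OF uniform_enc products])
qed

text \<open>With N = 2r - 1 points and blocks of length d, the recurrence has the additive part d *
  (2rN + 4rN^2) * T, and N \<le> 2r gives the constant 4r^2 + 16r^3. Growth by 2r per level leaves
  room for it: the recursive calls take 2r - 1 shares, the additive part at most the remaining
  one.\<close>

lemma polynomial_multiplication:
  fixes e :: "nat \<Rightarrow> 'f alg_closure"
  assumes r: "r \<ge> 1" and inj: "inj_on e {..<2 * r - 1}" and e: "\<And>i. i < 2 * r - 1 \<Longrightarrow> e i \<in> GF m"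
    and B: "B \<in> polys (r ^ k)"
  shows "computable_within ((4 * r ^ 2 + 16 * r ^ 3) * (2 * r) ^ k * T) (polys (r ^ k))
    (\<lambda>p. enc (r ^ k) (coeff p)) (\<lambda>p. enc (2 * r ^ k) (coeff (p * B)))"
  using B
proof (induction k arbitrary: B)
  case 0
  have "computable_within (2 * (1 * (2 * T))) (polys 1) (\<lambda>p. enc 1 (coeff p))
      (\<lambda>p. enc 2 (\<lambda>j. \<Sum>i<1. coeff B j * coeff p i))"
    using 0 by (intro computable_within_linear_map) (auto simp: polys_def)
  moreover have "coeff (p * B) j = coeff B j * coeff p 0" if "p \<in> polys 1" for p j
  proof -
    have "p = [:coeff p 0:]"
      using that by (auto simp: polys_def poly_eq_iff coeff_pCons split: nat.splits)
    then have "p * B = smult (coeff p 0) B"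
      by (metis mult_pCons_left mult_zero_left pCons_0_0 add.right_neutral)
    then show ?thesis by simp
  qed
  ultimately have "computable_within (4 * T) (polys 1) (\<lambda>p. enc 1 (coeff p))
      (\<lambda>p. enc 2 (coeff (p * B)))"
    by (auto elim!: computable_within_cong intro!: enc_cong)
  moreover have "4 * T \<le> (4 * r ^ 2 + 16 * r ^ 3) * T"
    using r by (intro mult_right_mono trans_le_add1) simp_all
  ultimately have "computable_within ((4 * r ^ 2 + 16 * r ^ 3) * T) (polys 1)
      (\<lambda>p. enc 1 (coeff p)) (\<lambda>p. enc 2 (coeff (p * B)))"
    by (rule computable_within_mono)
  then show ?case by simp
next
  case (Suc k)
  let ?N = "2 * r - 1" and ?K = "4 * r ^ 2 + 16 * r ^ 3" and ?d = "r ^ k"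
  have d: "?d > 0" using r by simp
  have "N * (d * (r * (2 * T)) + K * Z * T) + 2 * (r * d) * (N * N * (2 * T))
      = (d * (2 * r * N + 4 * r * N * N) + N * K * Z) * T" for N K d Z :: nat
    by (simp add: algebra_simps)
  then have "?N * (?d * (r * (2 * T)) + ?K * (2 * r) ^ k * T) + 2 * (r * ?d) * (?N * ?N * (2 * T))
      = (?d * (2 * r * ?N + 4 * r * ?N * ?N) + ?N * ?K * (2 * r) ^ k) * T"
    by blast
  also have "\<dots> \<le> ((2 * r) ^ k * ?K + ?N * ?K * (2 * r) ^ k) * T"
  proof -
    have "2 * r * ?N + 4 * r * ?N * ?N \<le> 2 * r * (2 * r) + 4 * r * (2 * r) * (2 * r)"
      by (intro add_mono mult_mono) auto
    also have "\<dots> = ?K"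
      by (simp add: power2_eq_square power3_eq_cube)
    finally have "2 * r * ?N + 4 * r * ?N * ?N \<le> ?K" .
    moreover have "?d \<le> (2 * r) ^ k"
      by (rule power_mono) auto
    ultimately show ?thesis
      by (intro mult_le_mono1 add_le_mono1 mult_le_mono)
  qed
  also have "\<dots> = ?K * (2 * r) ^ Suc k * T"
  proof -
    have "Z * K + N * K * Z = K * ((1 + N) * Z)" for N K Z :: nat
      by (simp add: algebra_simps)
    moreover have "1 + ?N = 2 * r" using r by simp
    ultimately show ?thesis by (simp only: power_Suc)
  qed
  finally have cost: "?N * (?d * (r * (2 * T)) + ?K * (2 * r) ^ k * T) + 2 * (r * ?d) * (?N * ?N * (2 * T))
      \<le> ?K * (2 * r) ^ Suc k * T" .
  have "B \<in> polys (r * ?d)"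
    using Suc.prems by simp
  from computable_within_mono[OF toom_cook_step[OF refl inj e d Suc.IH this] cost]
  show ?case
    by (simp only: power_Suc)
qed

text \<open>A Hankel product is the middle part of a polynomial product: with the vector reversed,
  the indices of \<open>v i\<close> and \<open>h (j + i)\<close> add up to n - 1 + j for every i.
  The constant factor is stored with 2n coefficients, hence the condition on
  \<open>r ^ k\<close>.\<close>

theorem hankel_product:
  fixes e :: "nat \<Rightarrow> 'f alg_closure"
  assumes r: "r \<ge> 1" and inj: "inj_on e {..<2 * r - 1}" and e: "\<And>i. i < 2 * r - 1 \<Longrightarrow> e i \<in> GF m"
    and h: "\<And>i. h i \<in> GF m" and n: "2 * n \<le> r ^ k"
  shows "computable_within ((4 * r ^ 2 + 16 * r ^ 3) * (2 * r) ^ k * T) {v. \<forall>i<n. v i \<in> GF m}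
    (enc n) (\<lambda>v. enc n (\<lambda>j. \<Sum>i<n. h (j + i) * v i))"
proof -
  let ?D = "{v. \<forall>i<n. v i \<in> (GF m :: 'f alg_closure set)}"
  let ?R = "r ^ k"
  define p where "p v = (\<Sum>i<n. monom (v i) (n - 1 - i))" for v :: "nat \<Rightarrow> 'f alg_closure"
  define B where "B = (\<Sum>i<2 * n. monom (h i) i)"
  have coeff_p: "coeff (p v) t = (if t < n then v (n - 1 - t) else 0)" for v t
  proof -
    have "coeff (p v) t = (\<Sum>i<n. if i = n - 1 - t \<and> t < n then v i else 0)"
      unfolding p_def coeff_sum by (intro sum.cong) auto
    then show ?thesis by auto
  qed
  have coeff_B: "coeff B t = (if t < 2 * n then h t else 0)" for t
    by (simp add: B_def coeff_sum)
  have B: "B \<in> polys ?R"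
    using h n by (auto simp: polys_def coeff_B)
  have p: "p v \<in> polys ?R" if "v \<in> ?D" for v
    using that n by (auto simp: polys_def coeff_p)
  have prod: "coeff (p v * B) (n - 1 + j) = (\<Sum>i<n. h (j + i) * v i)" if "j < n" for v j
  proof -
    have "coeff (p v * B) (n - 1 + j) = (\<Sum>i<n. coeff (monom (v i) (n - 1 - i) * B) (n - 1 + j))"
      by (simp add: p_def sum_distrib_right coeff_sum)
    also have "\<dots> = (\<Sum>i<n. h (j + i) * v i)"
    proof (rule sum.cong[OF refl])
      fix i assume "i \<in> {..<n}"
      then have "n - 1 - i \<le> n - 1 + j" "n - 1 + j - (n - 1 - i) = j + i" "j + i < 2 * n"
        using that by auto
      then show "coeff (monom (v i) (n - 1 - i) * B) (n - 1 + j) = h (j + i) * v i"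
        by (simp only: coeff_monom_mult coeff_B if_True not_less[THEN iffD2] if_False) (rule mult.commute)
    qed
    finally show ?thesis .
  qed
  \<comment> \<open>Reversing and padding with zeros to length \<open>r ^ k\<close> are
    free.\<close>
  have "computable_within (?R * 0) ?D (enc n) (\<lambda>v. enc ?R (coeff (p v)))"
  proof (rule computable_within_enc)
    fix t
    show "computable_within 0 ?D (enc n) (\<lambda>v. coords bs (coeff (p v) t))"
      using computable_within_nth[of "n - 1 - t" n ?D "\<lambda>v. v"]
        computable_within_const[OF uniform_enc[of ?D n "\<lambda>v. v"]]
      by (cases "t < n") (auto simp: coeff_p)
  qed (rule uniform_enc)
  moreover have "computable_within ((4 * r ^ 2 + 16 * r ^ 3) * (2 * r) ^ k * T) ?D
      (\<lambda>v. enc ?R (coeff (p v))) (\<lambda>v. enc (2 * ?R) (coeff (p v * B)))"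
    by (rule computable_within_instance[OF polynomial_multiplication[OF r inj e B] p])
  moreover have "computable_within (n * 0) ?D (\<lambda>v. enc (2 * ?R) (coeff (p v * B)))
      (\<lambda>v. enc n (\<lambda>j. \<Sum>i<n. h (j + i) * v i))"
  proof (rule computable_within_enc[OF uniform_enc])
    fix j assume j: "j < n"
    then have "n - 1 + j < 2 * ?R" using n by simp
    then show "computable_within 0 ?D (\<lambda>v. enc (2 * ?R) (coeff (p v * B)))
        (\<lambda>v. coords bs (\<Sum>i<n. h (j + i) * v i))"
      unfolding prod[OF j, symmetric] by (rule computable_within_nth)
  qed
  ultimately have "computable_within (?R * 0 + (4 * r ^ 2 + 16 * r ^ 3) * (2 * r) ^ k * T + n * 0) ?D (enc n)
      (\<lambda>v. enc n (\<lambda>j. \<Sum>i<n. h (j + i) * v i))"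
    using computable_within_seq[OF uniform_enc[of ?D n "\<lambda>v. v"]] by blast
  then show ?thesis by simp
qed

end

section \<open>The product modulo the field polynomial\<close>

lemma mat_to_list_mat:
  "concat (mat_to_list (mat n m f)) = concat (map (\<lambda>i. map (\<lambda>j. f (i, j)) [0..<m]) [0..<n])"
  unfolding mat_to_list_def
  by (intro arg_cong[of _ _ concat] map_cong) auto

context extension_arith
begin

lemma enc_eq_mat: "enc n v = concat (mat_to_list (mat n m (\<lambda>(k, t). coords bs (v k) ! t)))"
proof -
  have "coords bs x = map (\<lambda>t. coords bs x ! t) [0..<m]" for x
    using map_nth[of "coords bs x"] by simp
  then show ?thesis
    unfolding mat_to_list_mat enc_def by (auto intro!: arg_cong[of _ _ concat] map_cong)
qed

lemma computable_within_mat_mult: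
  fixes A B :: "'x \<Rightarrow> 'f mat"
  assumes M: "computable_within M (carrier_mat m m \<times> carrier_mat m m :: ('f mat \<times> 'f mat) set)
      (\<lambda>(A, B). concat (mat_to_list A) @ concat (mat_to_list B)) (\<lambda>(A, B). concat (mat_to_list (A * B)))"
    and unif: "uniform D inp"
    and A: "computable_within s D inp (\<lambda>x. concat (mat_to_list (A x)))" "\<And>x. x \<in> D \<Longrightarrow> A x \<in> carrier_mat m m"
    and B: "computable_within t D inp (\<lambda>x. concat (mat_to_list (B x)))" "\<And>x. x \<in> D \<Longrightarrow> B x \<in> carrier_mat m m"
  shows "computable_within (s + t + M) D inp (\<lambda>x. concat (mat_to_list (A x * B x)))"
proof -
  have "computable_within M D (\<lambda>x. concat (mat_to_list (A x)) @ concat (mat_to_list (B x)))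
      (\<lambda>x. concat (mat_to_list (A x * B x)))"
    using computable_within_instance[OF M, of D "\<lambda>x. (A x, B x)"] A(2) B(2) by simp
  then show ?thesis
    by (rule computable_within_seq[OF unif computable_within_append[OF unif A(1) B(1)]])
qed

text \<open>Evaluating a and b and recovering the coefficients of the remainder are three Hankel
  products, two with the conjugates and one with \<open>h\<close>. Rows of the matrices hold
  coordinates, so linear maps act from the right and the inner polynomial b comes first.\<close>

theorem computable_within_product:
  assumes H: "\<And>h. (\<And>i. h i \<in> GF m) \<Longrightarrow> computable_within H {v. \<forall>i<m. v i \<in> GF m}
      (enc m) (\<lambda>v. enc m (\<lambda>j. \<Sum>i<m. h (j + i) * v i))"
    and M: "computable_within M (carrier_mat m m \<times> carrier_mat m m :: ('f mat \<times> 'f mat) set)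
      (\<lambda>(A, B). concat (mat_to_list A) @ concat (mat_to_list B)) (\<lambda>(A, B). concat (mat_to_list (A * B)))"
  shows "computable_within (3 * H + 2 * M)
    {(a, b). a \<in> lin_polys m \<and> b \<in> lin_polys m \<and> qdeg a < ereal (real m) \<and> qdeg b < ereal (real m)}
    (\<lambda>(a, b). lin_coords m bs a @ lin_coords m bs b)
    (\<lambda>(a, b). lin_coords m bs (right_rem m (a \<circ>\<^sub>p b) (modulus m)))"
    (is "computable_within _ ?D ?inp ?out")
proof -
  obtain \<beta> :: "'f alg_closure" and h where \<beta>: "\<beta> \<in> GF m" and h: "\<And>i. h i \<in> GF m"
    and span: "\<And>x. x \<in> GF m \<Longrightarrow> \<exists>l. x = (\<Sum>i<m. to_ac (l i) * \<beta> ^ (CARD('f) ^ i))"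
    and inverse: "\<And>c j. j < m \<Longrightarrow> (\<Sum>k<m. h (j + k) * (\<Sum>i<m. \<beta> ^ (CARD('f) ^ (k + i)) * c i)) = c j"
    using normal_basis_evaluation[OF m] by blast
  define \<beta>s where "\<beta>s i = \<beta> ^ (CARD('f) ^ i)" for i
  have \<beta>s: "\<beta>s i \<in> GF m" for i
    unfolding \<beta>s_def by (rule GF_power[OF \<beta>])
  define ca where "ca a k = coeff a (CARD('f) ^ k)" for a :: "'f alg_closure poly" and k
  have lin_coords: "lin_coords m bs a = enc m (ca a)" for a
    by (simp add: lin_coords_def enc_def ca_def)
  define E where "E a j = (\<Sum>i<m. \<beta>s (j + i) * ca a i)" for a j
  have ca_GF: "ca a k \<in> GF m" if "a \<in> lin_polys m" for a k
    unfolding ca_def using that by (rule coeff_lin_polys_GF)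
  have E_GF: "E a j \<in> GF m" if "a \<in> lin_polys m" for a j
    unfolding E_def using ca_GF[OF that] \<beta>s by (intro GF_sum GF_mult)
  have linearized_ca: "linearized m (ca a) = a"
    if "a \<in> lin_polys m" "\<And>k. k \<ge> m \<Longrightarrow> coeff a (CARD('f) ^ k) = 0" for a
    using lin_polys_eq_linearized[OF that] by (simp add: ca_def[abs_def])
  have E_eq: "E a j = poly (linearized m (ca a)) (\<beta>s j)" for a j
    unfolding E_def poly_linearized \<beta>s_def by (simp add: power_add mult.commute flip: power_mult)
  have E_poly: "E a j = poly a (\<beta>s j)"
    if "a \<in> lin_polys m" "\<And>k. k \<ge> m \<Longrightarrow> coeff a (CARD('f) ^ k) = 0" for a j
    by (simp only: E_eq linearized_ca[OF that])
  have "\<exists>l. \<forall>s<m. bs ! s = (\<Sum>i<m. to_ac (l s i) * \<beta>s i)"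
  proof -
    have "\<exists>l. bs ! s = (\<Sum>i<m. to_ac (l i) * \<beta>s i)" if "s < m" for s
      unfolding \<beta>s_def using that length_basis ac.span_base[of "bs ! s" "set bs"] span_basis
      by (intro span) auto
    then show ?thesis by metis
  qed
  then obtain l where l: "\<And>s. s < m \<Longrightarrow> bs ! s = (\<Sum>i<m. to_ac (l s i) * \<beta>s i)"
    by blast
  \<comment> \<open>Row s expresses \<open>bs ! s\<close> by the conjugates. This is needed because
    values of b are represented in \<open>bs\<close>, whereas a is known by its values at the
    conjugates.\<close>
  define Q where "Q = mat m m (\<lambda>(s, i). l s i)"
  define Y where "Y a = mat m m (\<lambda>(k, t). coords bs (E a k) ! t)" for a
  have enc_E: "enc m (E a) = concat (mat_to_list (Y a))" for a
    unfolding Y_def by (rule enc_eq_mat)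
  have unif: "uniform ?D ?inp"
    by (rule uniformI[where n = "m * m + m * m"]) (auto simp: lin_coords)
  have D: "a \<in> lin_polys m" "b \<in> lin_polys m" "\<And>k. k \<ge> m \<Longrightarrow> coeff a (CARD('f) ^ k) = 0"
    "\<And>k. k \<ge> m \<Longrightarrow> coeff b (CARD('f) ^ k) = 0" if "(a, b) \<in> ?D" for a b
    using that qdeg_less_iff[of a m m] qdeg_less_iff[of b m m] by auto
  have eval: "computable_within H ?D (\<lambda>x. enc m (ca (f x))) (\<lambda>x. enc m (E (f x)))"
    if "\<And>x. x \<in> ?D \<Longrightarrow> f x \<in> lin_polys m" for f
    unfolding E_def
    by (rule computable_within_instance[OF H[of \<beta>s]]) (use that \<beta>s ca_GF in auto)
  have left: "computable_within (0 + H) ?D ?inp (\<lambda>x. concat (mat_to_list (Y (fst x))))"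
    unfolding enc_E[symmetric]
  proof (rule computable_within_seq[OF unif])
    show "computable_within 0 ?D ?inp (\<lambda>x. enc m (ca (fst x)))"
      unfolding lin_coords case_prod_beta by (rule computable_within_fst) simp
    show "computable_within H ?D (\<lambda>x. enc m (ca (fst x))) (\<lambda>x. enc m (E (fst x)))"
      by (rule eval) auto
  qed
  have right: "computable_within (0 + H) ?D ?inp (\<lambda>x. concat (mat_to_list (Y (snd x))))"
    unfolding enc_E[symmetric]
  proof (rule computable_within_seq[OF unif])
    show "computable_within 0 ?D ?inp (\<lambda>x. enc m (ca (snd x)))"
      unfolding lin_coords case_prod_beta by (rule computable_within_snd) simp_all
    show "computable_within H ?D (\<lambda>x. enc m (ca (snd x))) (\<lambda>x. enc m (E (snd x)))"
      by (rule eval) auto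
  qed
  have Y_carrier: "Y a \<in> carrier_mat m m" for a
    by (simp add: Y_def)
  have Q_carrier: "Q \<in> carrier_mat m m"
    by (simp add: Q_def)
  have YQ_carrier: "Y a * Q \<in> carrier_mat m m" for a
    using Y_carrier Q_carrier by (rule mult_carrier_mat)
  have prod: "computable_within (((0 + H) + 0 + M) + (0 + H) + M) ?D ?inp
      (\<lambda>x. concat (mat_to_list (Y (snd x) * Q * Y (fst x))))"
    by (intro computable_within_mat_mult[OF M unif] left right Y_carrier Q_carrier YQ_carrier
        computable_within_const[OF unif])
  define r where "r x = right_rem m (fst x \<circ>\<^sub>p snd x) (modulus m)" for x :: "'f alg_closure poly \<times> 'f alg_closure poly"
  have r: "r x \<in> lin_polys m" "\<And>k. k \<ge> m \<Longrightarrow> coeff (r x) (CARD('f) ^ k) = 0"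
    "\<And>y. y \<in> GF m \<Longrightarrow> poly (r x) y = poly (fst x) (poly (snd x) y)" if "x \<in> ?D" for x
  proof -
    have p: "fst x \<circ>\<^sub>p snd x \<in> lin_polys m"
      using that by (auto intro: lin_polys_pcompose)
    show "r x \<in> lin_polys m"
      unfolding r_def by (rule right_rem_lin_polys[OF p m])
    show "coeff (r x) (CARD('f) ^ k) = 0" if "k \<ge> m" for k
      unfolding r_def by (rule coeff_right_rem[OF p m that])
    show "poly (r x) y = poly (fst x) (poly (snd x) y)" if "y \<in> GF m" for y
      unfolding r_def poly_pcompose[symmetric] by (rule poly_right_rem[OF p m that])
  qed
  have product: "Y (snd x) * Q * Y (fst x) = Y (r x)" if x: "x \<in> ?D" for x
  proof (rule eq_matI)
    obtain a b where ab: "x = (a, b)" by (cases x)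
    note Dx = D[OF x[unfolded ab]]
    show "dim_row (Y (snd x) * Q * Y (fst x)) = dim_row (Y (r x))"
      "dim_col (Y (snd x) * Q * Y (fst x)) = dim_col (Y (r x))"
      by (simp_all add: Y_def)
    fix j t assume "j < dim_row (Y (r x))" "t < dim_col (Y (r x))"
    then have j: "j < m" and t: "t < m" by (simp_all add: Y_def)
    \<comment> \<open>Row j of \<open>Y b * Q\<close>: the coefficients of the value
      \<open>E b j\<close> with respect to the conjugates.\<close>
    define \<mu> where "\<mu> i = (\<Sum>s<m. coords bs (E b j) ! s * l s i)" for i
    have "E b j = (\<Sum>s<m. to_ac (coords bs (E b j) ! s) * bs ! s)"
      using sum_coords[OF E_GF[OF Dx(2)]] length_basis by simp
    also have "\<dots> = (\<Sum>s<m. \<Sum>i<m. to_ac (coords bs (E b j) ! s * l s i) * \<beta>s i)"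
      by (intro sum.cong refl) (simp only: lessThan_iff l sum_distrib_left to_ac_mult mult.assoc)
    also have "\<dots> = (\<Sum>i<m. to_ac (\<mu> i) * \<beta>s i)"
      by (subst sum.swap) (simp only: \<mu>_def to_ac_sum sum_distrib_right)
    finally have Eb: "E b j = (\<Sum>i<m. to_ac (\<mu> i) * \<beta>s i)" .
    \<comment> \<open>Reduction modulo the field polynomial does not change values on
      \<open>GF m\<close>.\<close>
    have "E (r x) j = poly a (E b j)"
      using r[OF x] \<beta>s E_poly Dx ab by simp
    also have "\<dots> = (\<Sum>i<m. to_ac (\<mu> i) * poly a (\<beta>s i))"
      unfolding Eb using sum_frobenius_linear[of m "ca a"] by (simp only: linearized_ca[OF Dx(1,3)])
    also have "\<dots> = (\<Sum>i<m. to_ac (\<mu> i) * E a i)"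
      using E_poly[OF Dx(1,3)] by simp
    finally have "coords bs (E (r x) j) ! t = (\<Sum>i<m. \<mu> i * coords bs (E a i) ! t)"
      using E_GF[OF Dx(1)] t length_basis by (simp add: coords_sum)
    then show "(Y (snd x) * Q * Y (fst x)) $$ (j, t) = Y (r x) $$ (j, t)"
      using j t by (simp add: ab Y_def Q_def \<mu>_def scalar_prod_def lessThan_atLeast0)
  qed
  have "computable_within H ?D (\<lambda>x. concat (mat_to_list (Y (snd x) * Q * Y (fst x)))) (\<lambda>x. enc m (ca (r x)))"
  proof -
    have "computable_within H ?D (\<lambda>x. enc m (E (r x))) (\<lambda>x. enc m (\<lambda>j. \<Sum>i<m. h (j + i) * E (r x) i))"
      by (rule computable_within_instance[OF H[OF h]]) (use r(1) E_GF in auto)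
    then show ?thesis
    proof (rule computable_within_cong)
      fix x assume x: "x \<in> ?D"
      show "concat (mat_to_list (Y (snd x) * Q * Y (fst x))) = enc m (E (r x))"
        by (simp add: product[OF x] enc_E)
      show "enc m (ca (r x)) = enc m (\<lambda>j. \<Sum>i<m. h (j + i) * E (r x) i)"
        using inverse by (intro enc_cong) (simp add: E_def \<beta>s_def)
    qed
  qed
  then have "computable_within ((((0 + H) + 0 + M) + (0 + H) + M) + H) ?D ?inp (\<lambda>x. enc m (ca (r x)))"
    by (rule computable_within_seq[OF unif prod])
  moreover have "(((0 + H) + 0 + M) + (0 + H) + M) + H = 3 * H + 2 * M" by simp
  ultimately have "computable_within (3 * H + 2 * M) ?D ?inp (\<lambda>x. enc m (ca (r x)))"
    by (simp only:)
  then show ?thesis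
    by (rule computable_within_cong) (auto simp: r_def lin_coords)
qed

end

section \<open>The cost bound\<close>

text \<open>With \<omega> \<le> 2 the assumption would put m^2 ln m into O(m^2), although the
  logarithm is unbounded.\<close>

lemma exponent_gt_2:
  assumes "(\<lambda>m. real m ^ 2 * ln (real m)) \<in> O(\<lambda>m. real m powr \<omega>)"
  shows "\<omega> > 2"
proof (rule ccontr)
  assume "\<not> \<omega> > 2"
  have "eventually (\<lambda>m. norm (real m powr \<omega>) \<le> 1 * norm (real m ^ 2)) at_top"
    using eventually_ge_at_top[of 1]
  proof eventually_elim
    case (elim m)
    then have "real m powr \<omega> \<le> real m powr 2"
      using \<open>\<not> \<omega> > 2\<close> by (intro powr_mono) auto
    then show ?case using elim by (simp add: powr_numeral)
  qed
  then have "(\<lambda>m. real m powr \<omega>) \<in> O(\<lambda>m. real m ^ 2)"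
    by (rule bigoI)
  with assms have "(\<lambda>m. real m ^ 2 * ln (real m)) \<in> O(\<lambda>m. real m ^ 2)"
    by (rule landau_o.big_trans)
  moreover have "(\<lambda>m. real m ^ 2) \<in> o(\<lambda>m. real m ^ 2 * ln (real m))"
    by real_asymp
  ultimately have "(\<lambda>m. real m ^ 2) \<in> o(\<lambda>m. real m ^ 2)"
    by (rule landau_o.small_big_trans[rotated])
  then have "eventually (\<lambda>m. real m ^ 2 = 0) at_top"
    by (simp add: landau_o.small_refl_iff)
  then have "eventually (\<lambda>m. False) (at_top :: nat filter)"
    using eventually_gt_at_top[of 0] by eventually_elim simp
  then show False by simp
qed

lemma powr_ln_power_bigo:
  assumes "a < b"
  shows "(\<lambda>m. real m powr a * ln (real m) ^ k) \<in> O(\<lambda>m. real m powr b)"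
proof -
  have "(\<lambda>m. ln (real m) ^ k) \<in> O(\<lambda>m. real m powr (b - a))"
    using assms by real_asymp
  then have "(\<lambda>m. real m powr a * ln (real m) ^ k) \<in> O(\<lambda>m. real m powr a * real m powr (b - a))"
    by (intro landau_o.big.mult) auto
  then show ?thesis
    by (simp flip: powr_add)
qed

text \<open>Padding a length to a power of r loses at most a factor r: the least sufficient exponent
  works.\<close>

lemma exists_power_between:
  fixes n r :: nat
  assumes "n \<ge> 1" "r \<ge> 2"
  obtains k where "n \<le> r ^ k" "r ^ k \<le> r * n"
proof -
  have "n \<le> r ^ n"
    using assms(2) by (simp add: power_gt_expt less_imp_le)
  define k where "k = (LEAST k. n \<le> r ^ k)"
  have k: "n \<le> r ^ k"
    unfolding k_def using \<open>n \<le> r ^ n\<close> by (rule LeastI)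
  moreover have "r ^ k \<le> r * n"
  proof (cases k)
    case (Suc j)
    then have "\<not> n \<le> r ^ j"
      unfolding k_def by (intro not_less_Least) simp
    then show ?thesis using Suc by simp
  qed (use assms in simp)
  ultimately show thesis by (rule that)
qed

text \<open>With r = 2^s, doubling the base multiplies the exponent by 1 + 1/s: (2r)^k = 2^(k(s +
  1)) = (r^k)^(1 + 1/s). For this the number of blocks is a power of two.\<close>

lemma double_base_power:
  fixes s k n :: nat
  assumes "s \<ge> 1" "(2 ^ s) ^ k \<le> 2 ^ s * n"
  shows "real ((2 * 2 ^ s) ^ k) \<le> real (2 ^ s * n) powr (1 + 1 / real s)"
proof -
  have "real ((2 * 2 ^ s) ^ k) = 2 powr (real k * (1 + real s))"
    by (simp add: powr_realpow[symmetric] powr_mult powr_powr powr_add algebra_simps flip: power_mult power_Suc)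
  also have "real k * (1 + real s) = real (s * k) * (1 + 1 / real s)"
    using assms(1) by (simp add: field_simps)
  also have "2 powr \<dots> = (2 powr real (s * k)) powr (1 + 1 / real s)"
    by (simp only: powr_powr)
  also have "2 powr real (s * k) = real ((2 ^ s) ^ k)"
    by (simp only: powr_realpow[OF zero_less_numeral] power_mult of_nat_power of_nat_numeral)
  also have "real ((2 ^ s) ^ k) powr (1 + 1 / real s) \<le> real (2 ^ s * n) powr (1 + 1 / real s)"
    using assms(2) by (intro powr_mono2) (simp_all only: of_nat_le_iff, auto)
  finally show ?thesis .
qed

lemma exists_inj_on_GF:
  assumes "m \<ge> 1" "n \<le> CARD('f::finite_field) ^ m"
  obtains e :: "nat \<Rightarrow> 'f::finite_field alg_closure" where "inj_on e {..<n}" "\<And>i. i < n \<Longrightarrow> e i \<in> GF m"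
proof -
  let ?G = "GF m :: 'f alg_closure set"
  obtain e where e: "bij_betw e {0..<card ?G} ?G"
    using ex_bij_betw_nat_finite[OF finite_GF[OF assms(1), where 'f = 'f]] by blast
  have "{..<n} \<subseteq> {0..<card ?G}"
    using assms(2) card_GF[OF assms(1), where 'f = 'f] by auto
  then show thesis
    using e by (intro that[of e]) (auto simp: bij_betw_def inj_on_subset)
qed

context extension_arith
begin

text \<open>Serves the finitely many m for which \<open>GF m\<close> has too few elements to supply
  the evaluation points.\<close>

lemma hankel_naive:
  assumes "\<And>i. h i \<in> GF m"
  shows "computable_within (m * (m * (2 * T))) {v. \<forall>i<m. v i \<in> GF m}
    (enc m) (\<lambda>v. enc m (\<lambda>j. \<Sum>i<m. h (j + i) * v i))"
  using computable_within_linear_map[of "{v. \<forall>i<m. v i \<in> GF m}" m "\<lambda>v. v" "\<lambda>j i. h (j + i)" m] assms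
  by simp

lemma hankel_fast:
  assumes s: "s \<ge> 1" and card: "2 * 2 ^ s - 1 \<le> CARD('f) ^ m"
  obtains H where "real H \<le> real (4 * (2 ^ s) ^ 2 + 16 * (2 ^ s) ^ 3) *
      real (2 ^ s * (2 * m)) powr (1 + 1 / real s) * real T"
    "\<And>h. (\<And>i. h i \<in> GF m) \<Longrightarrow> computable_within H {v. \<forall>i<m. v i \<in> GF m}
      (enc m) (\<lambda>v. enc m (\<lambda>j. \<Sum>i<m. h (j + i) * v i))"
proof -
  obtain e :: "nat \<Rightarrow> 'f alg_closure"
    where e: "inj_on e {..<2 * 2 ^ s - 1}" "\<And>i. i < 2 * 2 ^ s - 1 \<Longrightarrow> e i \<in> GF m"
    using exists_inj_on_GF[OF m card] by blast
  have "2 ^ 1 \<le> (2 ^ s :: nat)"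
    using s by (intro power_increasing) auto
  then obtain k where k: "2 * m \<le> (2 ^ s) ^ k" "(2 ^ s) ^ k \<le> 2 ^ s * (2 * m)"
    using exists_power_between[of "2 * m" "2 ^ s"] m by auto
  let ?C = "4 * (2 ^ s) ^ 2 + 16 * (2 ^ s) ^ 3 :: nat"
  have "real ?C * real ((2 * 2 ^ s) ^ k) * real T \<le>
      real ?C * real (2 ^ s * (2 * m)) powr (1 + 1 / real s) * real T"
    by (intro mult_right_mono mult_left_mono double_base_power[OF s k(2)]) auto
  then have "real (?C * (2 * 2 ^ s) ^ k * T) \<le>
      real ?C * real (2 ^ s * (2 * m)) powr (1 + 1 / real s) * real T"
    by (simp only: of_nat_mult)
  then show thesis
    using hankel_product[OF _ e _ k(1)] by (intro that[of "?C * (2 * 2 ^ s) ^ k * T"]) auto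
qed

end

theorem theorem20:
  fixes bs :: "nat \<Rightarrow> 'f::finite_field alg_closure list" and \<omega> :: real
  assumes bases: "fast_bases bs"
    and omega_le: "\<omega> \<le> 3"
    and matmul: "matmul_in TYPE('f) \<omega>"
    and log_factors: "\<And>k. (\<lambda>m. real m ^ 2 * ln (real m) ^ k) \<in> O(\<lambda>m. real m powr \<omega>)"
  shows "\<exists>T. (\<lambda>m. real (T m)) \<in> O(\<lambda>m. real m powr \<omega>) \<and>
    (\<forall>m\<ge>1. computable_within (T m)
       {(a, b). a \<in> lin_polys m \<and> b \<in> lin_polys m \<and> qdeg a < ereal (real m) \<and> qdeg b < ereal (real m)}
       (\<lambda>(a, b). lin_coords m (bs m) a @ lin_coords m (bs m) b)
       (\<lambda>(a, b). lin_coords m (bs m)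
          (right_rem m (a \<circ>\<^sub>p b) (monom 1 (CARD('f) ^ m) - monom 1 1))))"
proof -
  obtain T k where basis: "\<And>m. m \<ge> 1 \<Longrightarrow> is_basis m (bs m)"
    and T: "(\<lambda>m. real (T m)) \<in> O(\<lambda>m. real m * ln (real m) ^ k)"
    and arith: "\<And>m. m \<ge> 1 \<Longrightarrow> field_arith_within (T m) m (bs m)"
    using bases unfolding fast_bases_def by blast
  obtain M where M: "(\<lambda>N. real (M N)) \<in> O(\<lambda>N. real N powr \<omega>)"
    and mat: "\<And>N. computable_within (M N) (carrier_mat N N \<times> carrier_mat N N :: ('f mat \<times> 'f mat) set)
      (\<lambda>(A, B). concat (mat_to_list A) @ concat (mat_to_list B)) (\<lambda>(A, B). concat (mat_to_list (A * B)))"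
    using matmul unfolding matmul_in_def by blast
  have "\<omega> > 2"
    using log_factors[of 1] exponent_gt_2 by simp
  \<comment> \<open>The fast conversions take about m^(1 + 1/s) field operations of cost about m
    each; the strict inequality also absorbs the logarithms.\<close>
  then obtain s0 where s0: "inverse (real (Suc s0)) < \<omega> - 2"
    using reals_Archimedean[of "\<omega> - 2"] by auto
  define s where "s = Suc s0"
  have s: "s \<ge> 1" "2 + 1 / real s < \<omega>"
    using s0 by (simp_all add: s_def inverse_eq_divide)
  define C where "C = real (4 * (2 ^ s) ^ 2 + 16 * (2 ^ s) ^ 3)"
  \<comment> \<open>The bound on H is asserted only where enough evaluation points exist; for the
    other m any working cost will do.\<close>
  define P where "P m H \<longleftrightarrow> (2 * 2 ^ s - 1 \<le> CARD('f) ^ m \<longrightarrow>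
        real H \<le> C * real (2 ^ s * (2 * m)) powr (1 + 1 / real s) * real (T m)) \<and>
      computable_within (3 * H + 2 * M m)
       {(a, b). a \<in> lin_polys m \<and> b \<in> lin_polys m \<and> qdeg a < ereal (real m) \<and> qdeg b < ereal (real m)}
       (\<lambda>(a, b). lin_coords m (bs m) a @ lin_coords m (bs m) b)
       (\<lambda>(a, b). lin_coords m (bs m)
          (right_rem m (a \<circ>\<^sub>p b) (monom 1 (CARD('f) ^ m) - monom 1 1)))" for m H
  have "\<exists>H. P m H" if m: "m \<ge> 1" for m
  proof -
    interpret extension_arith m "T m" "bs m"
      using m basis arith by unfold_locales auto
    show ?thesis
    proof (cases "2 * 2 ^ s - 1 \<le> CARD('f) ^ m")
      case True
      show ?thesis
      proof (rule hankel_fast[OF s(1) True, folded C_def])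
        fix H
        assume H: "real H \<le> C * real (2 ^ s * (2 * m)) powr (1 + 1 / real s) * real (T m)"
        and hankel: "\<And>h. (\<And>i. h i \<in> GF m) \<Longrightarrow> computable_within H {v. \<forall>i<m. v i \<in> GF m}
          (enc m) (\<lambda>v. enc m (\<lambda>j. \<Sum>i<m. h (j + i) * v i))"
        show ?thesis
          unfolding P_def by (intro exI[of _ H] conjI impI computable_within_product[OF hankel mat] H)
      qed
    next
      case False
      then show ?thesis
        unfolding P_def
        by (intro exI[of _ "m * (m * (2 * T m))"] conjI impI computable_within_product[OF hankel_naive mat]) auto
    qed
  qed
  then obtain H where "\<And>m. m \<ge> 1 \<Longrightarrow> P m (H m)"
    by metis
  then have H: "\<And>m. m \<ge> 1 \<Longrightarrow> 2 * 2 ^ s - 1 \<le> CARD('f) ^ m \<Longrightarrow>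
        real (H m) \<le> C * real (2 ^ s * (2 * m)) powr (1 + 1 / real s) * real (T m)"
    and comp: "\<And>m. m \<ge> 1 \<Longrightarrow> computable_within (3 * H m + 2 * M m)
       {(a, b). a \<in> lin_polys m \<and> b \<in> lin_polys m \<and> qdeg a < ereal (real m) \<and> qdeg b < ereal (real m)}
       (\<lambda>(a, b). lin_coords m (bs m) a @ lin_coords m (bs m) b)
       (\<lambda>(a, b). lin_coords m (bs m)
          (right_rem m (a \<circ>\<^sub>p b) (monom 1 (CARD('f) ^ m) - monom 1 1)))"
    unfolding P_def by auto
  have "(\<lambda>m. real (H m)) \<in> O(\<lambda>m. real m powr \<omega>)"
  proof -
    let ?e = "1 + 1 / real s"
    have "eventually (\<lambda>m. norm (real (H m)) \<le>
        C * real (2 ^ s * 2) powr ?e * norm (real m powr ?e * real (T m))) at_top"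
      \<comment> \<open>From here on q^m > m \<ge> 2r, so the 2r - 1 points exist.\<close>
      using eventually_ge_at_top[of "2 * 2 ^ s"]
    proof eventually_elim
      case (elim m)
      have "m < CARD('f) ^ m"
        using card_finite_field_gt_1[where 'f = 'f] by (simp add: power_gt_expt)
      moreover have "1 \<le> 2 * (2 :: nat) ^ s" by simp
      ultimately have "real (H m) \<le> C * real (2 ^ s * (2 * m)) powr ?e * real (T m)"
        using elim by (intro H) linarith+
      also have "real (2 ^ s * (2 * m)) powr ?e = real (2 ^ s * 2) powr ?e * real m powr ?e"
        by (simp add: powr_mult)
      finally show ?case
        by (simp add: mult.assoc)
    qed
    then have "(\<lambda>m. real (H m)) \<in> O(\<lambda>m. real m powr ?e * real (T m))"
      by (rule bigoI)
    also have "(\<lambda>m. real m powr ?e * real (T m)) \<in> O(\<lambda>m. real m powr ?e * (real m * ln (real m) ^ k))"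
      by (intro landau_o.big.mult_left T)
    also have "(\<lambda>m. real m powr ?e * (real m * ln (real m) ^ k)) =
        (\<lambda>m. real m powr (2 + 1 / real s) * ln (real m) ^ k)"
    proof
      fix m
      have "2 + 1 / real s = ?e + 1"
        by simp
      then have "real m powr (2 + 1 / real s) = real m powr ?e * real m powr 1"
        by (simp only: powr_add)
      then show "real m powr ?e * (real m * ln (real m) ^ k) =
          real m powr (2 + 1 / real s) * ln (real m) ^ k"
        by (simp add: mult.assoc)
    qed
    also have "\<dots> \<in> O(\<lambda>m. real m powr \<omega>)"
      by (rule powr_ln_power_bigo[OF s(2)])
    finally show ?thesis .
  qed
  then have "(\<lambda>m. 3 * real (H m) + 2 * real (M m)) \<in> O(\<lambda>m. real m powr \<omega>)"
    using M by (intro sum_in_bigo) simp_all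
  then show ?thesis
    using comp by (intro exI[of _ "\<lambda>m. 3 * H m + 2 * M m"]) simp
qed

end
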